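(* Let $(\varepsilon_t)_{t\in\mathbb{Z}}$ be i.i.d. copies of a random variable $\varepsilon$, $Y$ measurable and $X_t=Y(\varepsilon_t,\varepsilon_{t-1},\dots)$. Fix $\tau\in(0,1)$ and suppose: (B) $F_X$ is Lipschitz continuous in a neighborhood of $\xi_0(\tau)$ and has a positive and continuous Lebesgue density at $\xi_0(\tau)$; (C) there exists $\delta>0$ such that $\sum_{t=0}^\infty\sup_{\xi\in\mathcal{X}_\tau(\delta)}\|1\{X_t<\xi\}-1\{X_t^*<\xi\}\|_2<\infty$. Let $w\in\mathcal{W}$ and let $B_n\to\infty$ with $B_n=o(\sqrt n)$. Then $$\sup_{\lambda\in(-\pi,\pi]}|\hat g_{n,\tau}(\lambda)-g_\tau(\lambda)|\to0\quad\text{in probability}.$$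
   Context: $\varepsilon_0^*$ is an independent copy of $\varepsilon_0$ (independent of $(\varepsilon_t)$) and $X_t^*=Y(\varepsilon_t,\dots,\varepsilon_1,\varepsilon_0^*,\varepsilon_{-1},\varepsilon_{-2},\dots)$. $\|Z\|_2=(\mathbb{E}|Z|^2)^{1/2}$. $F_X(x)=\mathbb{P}(X_0\le x)$, $\xi_0(\tau)=\inf\{x:F_X(x)\ge\tau\}$, $\mathcal{X}_\tau(\delta)=\{\xi:|\xi_0(\tau)-\xi|\le\delta\}$. $V_t(\tau,\xi)=\tau-1\{X_t<\xi\}$, $V_t(\tau)=V_t(\tau,\xi_0(\tau))$, $r_\tau(j)=\mathbb{E}V_0(\tau)V_j(\tau)$, $g_\tau(\lambda)=\frac{1}{2\pi}\sum_{j\in\mathbb{Z}}r_\tau(j)\cos(j\lambda)$. Given $X_1,\dots,X_n$: $\hat\xi_n(\tau)$ minimizes $\sum_{t=1}^n\rho_\tau(X_t-x)$, $\rho_\tau(x)=x(\tau-1\{x<0\})$; $\hat V_t(\tau)=V_t(\tau,\hat\xi_n(\tau))$; $\hat r_{n,\tau}(j)=n^{-1}\sum_{t=|j|+1}^n\hat V_t(\tau)\hat V_{t-|j|}(\tau)$ for $|j|<n$; $\hat g_{n,\tau}(\lambda)=\frac{1}{2\pi}\sum_{|j|<n}w(j/B_n)\hat r_{n,\tau}(j)\cos(j\lambda)$. $\mathcal{W}$ is the set of bounded continuous functions $w:\mathbb{R}\to\mathbb{R}$ with $w(x)=w(-x)$, $w(0)=1$, such that $\bar w(x)=\sup_{y\ge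 x}|w(y)|$ satisfies $\int_0^\infty\bar w(x)\,dx<\infty$ and $W(\lambda)=(2\pi)^{-1}\int_{-\infty}^\infty w(x)e^{-ix\lambda}dx$ satisfies $\int_{-\infty}^\infty|W(\lambda)|d\lambda<\infty$. *)

theory Defs
  imports "HOL-Probability.Probability"
begin

definition Xs :: "((nat \<Rightarrow> 'e) \<Rightarrow> real) \<Rightarrow> (int \<Rightarrow> 'w \<Rightarrow> 'e) \<Rightarrow> int \<Rightarrow> 'w \<Rightarrow> real" where
  "Xs Y eps t \<omega> = Y (\<lambda>k. eps (t - int k) \<omega>)"

text \<open>Coupled version: eps_0 replaced by the independent copy e0s.\<close>
definition Xstar :: "((nat \<Rightarrow> 'e) \<Rightarrow> real) \<Rightarrow> (int \<Rightarrow> 'w \<Rightarrow> 'e) \<Rightarrow> ('w \<Rightarrow> 'e) \<Rightarrow> int \<Rightarrow> 'w \<Rightarrow> real" where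
  "Xstar Y eps e0s t \<omega> = Y (\<lambda>k. if t - int k = 0 then e0s \<omega> else eps (t - int k) \<omega>)"

definition ind_lt :: "real \<Rightarrow> real \<Rightarrow> real" where
  "ind_lt x \<xi> = (if x < \<xi> then 1 else 0)"

definition L2norm :: "'w measure \<Rightarrow> ('w \<Rightarrow> real) \<Rightarrow> real" where
  "L2norm M Z = sqrt (LINT \<omega>|M. (Z \<omega>)\<^sup>2)"

definition FX :: "'w measure \<Rightarrow> ((nat \<Rightarrow> 'e) \<Rightarrow> real) \<Rightarrow> (int \<Rightarrow> 'w \<Rightarrow> 'e) \<Rightarrow> real \<Rightarrow> real" where
  "FX M Y eps x = measure M {\<omega> \<in> space M. Xs Y eps 0 \<omega> \<le> x}"

definition xi0 :: "'w measure \<Rightarrow> ((nat \<Rightarrow> 'e) \<Rightarrow> real) \<Rightarrow> (int \<Rightarrow> 'w \<Rightarrow> 'e) \<Rightarrow> real \<Rightarrow> real" where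
  "xi0 M Y eps \<tau> = Inf {x. FX M Y eps x \<ge> \<tau>}"

definition Vt :: "((nat \<Rightarrow> 'e) \<Rightarrow> real) \<Rightarrow> (int \<Rightarrow> 'w \<Rightarrow> 'e) \<Rightarrow> real \<Rightarrow> real \<Rightarrow> int \<Rightarrow> 'w \<Rightarrow> real" where
  "Vt Y eps \<tau> \<xi> t \<omega> = \<tau> - ind_lt (Xs Y eps t \<omega>) \<xi>"

definition r_tau :: "'w measure \<Rightarrow> ((nat \<Rightarrow> 'e) \<Rightarrow> real) \<Rightarrow> (int \<Rightarrow> 'w \<Rightarrow> 'e) \<Rightarrow> real \<Rightarrow> int \<Rightarrow> real" where
  "r_tau M Y eps \<tau> j = (LINT \<omega>|M. Vt Y eps \<tau> (xi0 M Y eps \<tau>) 0 \<omega> * Vt Y eps \<tau> (xi0 M Y eps \<tau>) j \<omega>)"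

definition g_tau :: "'w measure \<Rightarrow> ((nat \<Rightarrow> 'e) \<Rightarrow> real) \<Rightarrow> (int \<Rightarrow> 'w \<Rightarrow> 'e) \<Rightarrow> real \<Rightarrow> real \<Rightarrow> real" where
  "g_tau M Y eps \<tau> lam = (1 / (2 * pi)) * (\<Sum>\<^sub>\<infinity> j::int. r_tau M Y eps \<tau> j * cos (real_of_int j * lam))"

definition rho :: "real \<Rightarrow> real \<Rightarrow> real" where
  "rho \<tau> x = x * (\<tau> - (if x < 0 then 1 else 0))"

definition is_quantile_min :: "((nat \<Rightarrow> 'e) \<Rightarrow> real) \<Rightarrow> (int \<Rightarrow> 'w \<Rightarrow> 'e) \<Rightarrow> real \<Rightarrow> nat \<Rightarrow> 'w \<Rightarrow> real \<Rightarrow> bool" where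
  "is_quantile_min Y eps \<tau> n \<omega> q \<longleftrightarrow>
     (\<forall>x. (\<Sum>t\<in>{1..int n}. rho \<tau> (Xs Y eps t \<omega> - q)) \<le> (\<Sum>t\<in>{1..int n}. rho \<tau> (Xs Y eps t \<omega> - x)))"

text \<open>hat r_{n,tau}(j), given the estimated quantile q = hat xi_n(tau).\<close>
definition r_hat :: "((nat \<Rightarrow> 'e) \<Rightarrow> real) \<Rightarrow> (int \<Rightarrow> 'w \<Rightarrow> 'e) \<Rightarrow> real \<Rightarrow> nat \<Rightarrow> real \<Rightarrow> int \<Rightarrow> 'w \<Rightarrow> real" where
  "r_hat Y eps \<tau> n q j \<omega> = (1 / real n) *
     (\<Sum>t\<in>{\<bar>j\<bar>+1..int n}. Vt Y eps \<tau> q t \<omega> * Vt Y eps \<tau> q (t - \<bar>j\<bar>) \<omega>)"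

definition g_hat :: "((nat \<Rightarrow> 'e) \<Rightarrow> real) \<Rightarrow> (int \<Rightarrow> 'w \<Rightarrow> 'e) \<Rightarrow> real \<Rightarrow> (real \<Rightarrow> real) \<Rightarrow> real \<Rightarrow> nat \<Rightarrow> real \<Rightarrow> 'w \<Rightarrow> real \<Rightarrow> real" where
  "g_hat Y eps \<tau> w Bn n q \<omega> lam = (1 / (2 * pi)) *
     (\<Sum>j\<in>{-(int n)<..<int n}. w (real_of_int j / Bn) * r_hat Y eps \<tau> n q j \<omega> * cos (real_of_int j * lam))"

definition wbar :: "(real \<Rightarrow> real) \<Rightarrow> real \<Rightarrow> real" where
  "wbar w x = (SUP y\<in>{x..}. \<bar>w y\<bar>)"

definition Wtrans :: "(real \<Rightarrow> real) \<Rightarrow> real \<Rightarrow> complex" where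
  "Wtrans w lam = (1 / (2 * pi)) * (LINT x|lborel. complex_of_real (w x) * exp (- \<i> * complex_of_real (x * lam)))"

definition in_W :: "(real \<Rightarrow> real) \<Rightarrow> bool" where
  "in_W w \<longleftrightarrow> bounded (range w) \<and> continuous_on UNIV w \<and> (\<forall>x. w x = w (- x)) \<and> w 0 = 1
     \<and> set_integrable lborel {0..} (wbar w)
     \<and> integrable lborel (\<lambda>l. cmod (Wtrans w l))"

end

theory Submission
  imports Defs
begin

text \<open>
  Let \<open>\<delta> f i\<close> be the \<open>L\<^sup>2\<close> change of a bounded functional \<open>f\<close> of an i.i.d. sequence when coordinate \<open>i\<close> is
  replaced by an independent copy. Passing from a sequence to an independent one coordinate by
  coordinate gives the Efron--Stein type bound \<open>2 * \<bar>Cov f g\<bar> \<le> (\<Sum>i. \<delta> f i * \<delta> g i)\<close>. Hence under (C)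
  autocovariances are summable, and sums of \<open>n\<close> terms of \<open>V t\<close>, or of \<open>V t * V (t - j)\<close>, have
  variance \<open>O(n)\<close>, uniformly in the lag \<open>j\<close>.

  With \<open>d n = (B n * sqrt n) powr (-1/2)\<close>, Chebyshev's inequality at \<open>\<xi>\<^sub>0 \<plusminus> d n\<close> localizes the sample
  quantile in \<open>[\<xi>\<^sub>0 - d n, \<xi>\<^sub>0 + d n]\<close> and bounds the number of observations in that window by
  \<open>O(n * d n)\<close>. By monotonicity of the indicators in the level, every \<open>r_hat\<close> then changes by \<open>O(d n)\<close>
  when the estimated quantile is replaced by \<open>\<xi>\<^sub>0\<close>. Since the kernel weights sum to \<open>O(B n)\<close>, this costs
  \<open>O(B n * d n)\<close>, the centred terms cost \<open>O(B n / sqrt n)\<close> in mean, and the remaining bias vanishes by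
  dominated convergence.
\<close>

subsection \<open>Integrals over i.i.d. product spaces\<close>

text \<open>The estimated quantile depends on the whole sample and enters through discontinuous
  indicators, so there is no smooth expansion in the level. Moments are therefore computed only at
  deterministic levels, and the passage to \<open>xihat\<close> is a pathwise inequality. The levels
  \<open>\<xi>\<^sub>0 \<plusminus> d n\<close> move with \<open>n\<close>; this is what the
  supremum over levels in (C) serves for.

  Moments are computed on product spaces, where shifting, exchanging or replacing innovations is a
  reindexing along an injection and preserves integrals. The covariance bound has to contain the
  influences of both factors: the sum over lags \<open>h\<close> of
  \<open>\<Sum>i. \<delta> (i + h) * \<delta> i\<close> is at most the square of the total
  influence, whereas the increment of one factor alone shows no decay in the lag. Influences of
  products are subadditive, so the total influence of \<open>V t * V (t - j)\<close> is at most
  twice that of \<open>V\<close>, whatever the lag. Frequencies enter only through cosines bounded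
  by 1, so every bound is uniform in \<open>lam\<close>.\<close>

lemma (in prob_space) integrable_bounded:
  fixes f :: "'a \<Rightarrow> real"
  assumes "f \<in> borel_measurable M" "\<And>x. \<bar>f x\<bar> \<le> C"
  shows "integrable M f"
  using assms by (intro integrable_const_bound[where B=C]) auto

lemma (in prob_space) abs_integral_le_const:
  fixes f :: "'a \<Rightarrow> real"
  assumes f: "f \<in> borel_measurable M" "\<And>x. \<bar>f x\<bar> \<le> C"
  shows "\<bar>integral\<^sup>L M f\<bar> \<le> C"
proof -
  have "\<bar>integral\<^sup>L M f\<bar> \<le> (\<integral>x. \<bar>f x\<bar> \<partial>M)"
    by (rule integral_abs_bound)
  also have "\<dots> \<le> (\<integral>x. C \<partial>M)"
    using f integrable_bounded[OF f] by (intro integral_mono) auto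
  finally show ?thesis by (simp add: prob_space)
qed

section \<open>Cauchy--Schwarz and triangle inequalities for \<open>L2norm\<close>\<close>

lemma Cauchy_Schwarz_integral:
  fixes f g :: "'a \<Rightarrow> real"
  assumes f: "integrable M (\<lambda>x. (f x)\<^sup>2)" and g: "integrable M (\<lambda>x. (g x)\<^sup>2)"
    and fg: "integrable M (\<lambda>x. f x * g x)"
  shows "\<bar>\<integral>x. f x * g x \<partial>M\<bar> \<le> L2norm M f * L2norm M g"
proof -
  define A B C where "A = (\<integral>x. (f x)\<^sup>2 \<partial>M)" and "B = (\<integral>x. f x * g x \<partial>M)"
    and "C = (\<integral>x. (g x)\<^sup>2 \<partial>M)"
  have quad: "0 \<le> A + 2 * a * B + a\<^sup>2 * C" for a
  proof -
    have "0 \<le> (\<integral>x. (f x + a * g x)\<^sup>2 \<partial>M)" by simp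
    also have "(\<lambda>x. (f x + a * g x)\<^sup>2) = (\<lambda>x. (f x)\<^sup>2 + (2 * a) * (f x * g x) + a\<^sup>2 * (g x)\<^sup>2)"
      by (auto simp: power2_eq_square algebra_simps)
    also have "(\<integral>x. (f x)\<^sup>2 + (2 * a) * (f x * g x) + a\<^sup>2 * (g x)\<^sup>2 \<partial>M) = A + 2 * a * B + a\<^sup>2 * C"
      unfolding A_def B_def C_def using f g fg by simp
    finally show ?thesis .
  qed
  have A0: "A \<ge> 0" and C0: "C \<ge> 0" by (auto simp: A_def C_def)
  have "B\<^sup>2 \<le> A * C"
  proof (cases "C = 0")
    case True
    have "B = 0"
    proof (rule ccontr)
      assume "B \<noteq> 0"
      \<comment> \<open>For \<open>C = 0\<close> the quadratic in \<open>a\<close> is affine, and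
        this \<open>a\<close> gives it the value \<open>-1\<close>.\<close>
      with quad[of "- (A + 1) / (2 * B)"] True A0 show False by (simp add: field_simps)
    qed
    with True show ?thesis by simp
  next
    case False
    with C0 have "C > 0" by simp
    have "0 \<le> A + 2 * (- B / C) * B + (- B / C)\<^sup>2 * C" by (rule quad)
    also have "\<dots> = A - B\<^sup>2 / C"
      using \<open>C > 0\<close> by (simp add: power2_eq_square field_simps)
    finally show ?thesis using \<open>C > 0\<close> by (simp add: field_simps)
  qed
  then have "sqrt (B\<^sup>2) \<le> sqrt (A * C)" by (rule real_sqrt_le_mono)
  then show ?thesis
    by (simp add: L2norm_def A_def B_def C_def real_sqrt_mult)
qed

lemma L2norm_nonneg [simp]: "0 \<le> L2norm M f"
  by (simp add: L2norm_def)

lemma L2norm_triangle: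
  assumes "integrable M (\<lambda>x. (f x)\<^sup>2)" "integrable M (\<lambda>x. (g x)\<^sup>2)" "integrable M (\<lambda>x. f x * g x)"
  shows "L2norm M (\<lambda>x. f x + g x) \<le> L2norm M f + L2norm M g"
proof -
  have "(\<lambda>x. (f x + g x)\<^sup>2) = (\<lambda>x. (f x)\<^sup>2 + 2 * (f x * g x) + (g x)\<^sup>2)"
    by (auto simp: power2_eq_square algebra_simps)
  then have "(\<integral>x. (f x + g x)\<^sup>2 \<partial>M) = (L2norm M f)\<^sup>2 + 2 * (\<integral>x. f x * g x \<partial>M) + (L2norm M g)\<^sup>2"
    using assms by (simp add: L2norm_def)
  also have "\<dots> \<le> (L2norm M f + L2norm M g)\<^sup>2"
    using Cauchy_Schwarz_integral[OF assms] by (simp add: power2_sum)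
  finally show ?thesis
    unfolding L2norm_def[of M "\<lambda>x. f x + g x"] by (intro real_le_lsqrt) auto
qed

lemma L2norm_mono:
  assumes "integrable M (\<lambda>x. (g x)\<^sup>2)" "f \<in> borel_measurable M" "\<And>x. \<bar>f x\<bar> \<le> \<bar>g x\<bar>"
  shows "L2norm M f \<le> L2norm M g"
proof -
  have le: "(f x)\<^sup>2 \<le> (g x)\<^sup>2" for x using assms(3) by (simp add: abs_le_square_iff)
  have "integrable M (\<lambda>x. (f x)\<^sup>2)"
    by (rule Bochner_Integration.integrable_bound[OF assms(1)]) (use assms(2) le in auto)
  then show ?thesis
    unfolding L2norm_def using assms(1) le by (intro real_sqrt_le_mono integral_mono) auto
qed

text \<open>The index type stays free because the same i.i.d. law is needed over several index sets:
  \<open>nat\<close> for the past of one time point, \<open>int\<close> for the whole noise, option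
  types for one additional copy, \<open>nat \<times> bool\<close> for two independent
  sequences.\<close>

abbreviation iid_PiM :: "'e measure \<Rightarrow> ('i \<Rightarrow> 'e) measure" where
  "iid_PiM D \<equiv> PiM UNIV (\<lambda>_. D)"

lemma measurable_reindex: "(\<lambda>x i. x (\<phi> i)) \<in> iid_PiM D \<rightarrow>\<^sub>M iid_PiM D"
  by (rule measurable_PiM_single') (auto simp: space_PiM)

lemma measurable_compose_reindex:
  "f \<in> borel_measurable (iid_PiM D) \<Longrightarrow> (\<lambda>x. f (\<lambda>i. x (\<phi> i))) \<in> borel_measurable (iid_PiM D)"
  by (rule measurable_compose[OF measurable_reindex])

context prob_space
begin

text \<open>An injection selects distinct coordinates, and distinct coordinates of an i.i.d. family
  are again i.i.d. Shifts, exchanges of coordinates and embeddings into a larger index set are all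
  instances.\<close>

lemma distr_reindex:
  assumes "inj \<phi>"
  shows "distr (iid_PiM M) (iid_PiM M) (\<lambda>x i. x (\<phi> i)) = iid_PiM M"
  using distr_PiM_reindex[of UNIV "\<lambda>_. M" \<phi> UNIV] assms prob_space_axioms
  by (simp add: restrict_def)

lemma integral_reindex:
  fixes f :: "_ \<Rightarrow> real"
  assumes "inj \<phi>" "f \<in> borel_measurable (iid_PiM M)"
  shows "(\<integral>x. f (\<lambda>i. x (\<phi> i)) \<partial>iid_PiM M) = (\<integral>x. f x \<partial>iid_PiM M)"
  using integral_distr[OF measurable_reindex assms(2), of \<phi>] distr_reindex[OF assms(1)] by simp

lemma prob_space_iid: "prob_space (iid_PiM M)"
  by (intro prob_space_PiM) (rule prob_space_axioms)

lemma indep_vars_coord: "prob_space.indep_vars (iid_PiM M :: ('i \<Rightarrow> 'a) measure) (\<lambda>_. M) (\<lambda>i x. x i) UNIV"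
proof -
  let ?P = "iid_PiM M :: ('i \<Rightarrow> 'a) measure"
  interpret P: prob_space ?P by (rule prob_space_iid)
  have "distr ?P M (\<lambda>x. x i) = M" for i
    using distr_PiM_component[of "UNIV :: 'i set" "\<lambda>_. M" i] prob_space_axioms by simp
  moreover have "distr ?P ?P (\<lambda>x. x) = ?P"
    by (rule distr_id2) simp
  ultimately show ?thesis
    by (subst P.indep_vars_iff_distr_eq_PiM') (auto simp: restrict_def)
qed

text \<open>Functionals that read disjoint blocks of coordinates are independent. The tail limit
  below uses this for cylinder sets, where the factorization is exact from some \<open>m\<close>
  on.\<close>

lemma integral_mult_disjoint:
  fixes f g :: "_ \<Rightarrow> real"
  assumes \<phi>: "inj \<phi>" "inj \<psi>" and disj: "range \<phi> \<inter> range \<psi> = {}"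
    and f: "f \<in> borel_measurable (iid_PiM M)" "\<And>x. \<bar>f x\<bar> \<le> C"
    and g: "g \<in> borel_measurable (iid_PiM M)" "\<And>x. \<bar>g x\<bar> \<le> C'"
  shows "(\<integral>x. f (\<lambda>i. x (\<phi> i)) * g (\<lambda>i. x (\<psi> i)) \<partial>iid_PiM M)
    = (\<integral>x. f x \<partial>iid_PiM M) * (\<integral>x. g x \<partial>iid_PiM M)"
proof -
  interpret P: prob_space "iid_PiM M" by (rule prob_space_iid)
  \<comment> \<open>Read along \<kappa>, \<open>h\<close> depends only on the coordinates in
    \<open>range \<kappa>\<close>, so it factors through the restriction to that block; independence
    is available for such restrictions.\<close>
  have m: "(\<lambda>x. h (\<lambda>i. x (\<kappa> i))) \<in> borel_measurable (PiM (range \<kappa>) (\<lambda>_. M))"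
    if "h \<in> borel_measurable (iid_PiM M)" for h :: "_ \<Rightarrow> real" and \<kappa>
  proof (rule measurable_compose[OF _ that])
    show "(\<lambda>x i. x (\<kappa> i)) \<in> PiM (range \<kappa>) (\<lambda>_. M) \<rightarrow>\<^sub>M iid_PiM M"
      by (rule measurable_PiM_single') (auto simp: space_PiM PiE_iff intro!: measurable_component_singleton)
  qed
  have "P.indep_var borel ((\<lambda>x. f (\<lambda>i. x (\<phi> i))) \<circ> (\<lambda>x. restrict x (range \<phi>)))
                    borel ((\<lambda>x. g (\<lambda>i. x (\<psi> i))) \<circ> (\<lambda>x. restrict x (range \<psi>)))"
    by (rule P.indep_var_compose[OF P.indep_var_restrict[OF indep_vars_coord disj] m[OF f(1)] m[OF g(1)]]) simp_all
  then have "P.indep_var borel (\<lambda>x. f (\<lambda>i. x (\<phi> i))) borel (\<lambda>x. g (\<lambda>i. x (\<psi> i)))"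
    by (simp add: o_def restrict_def)
  then have "(\<integral>x. f (\<lambda>i. x (\<phi> i)) * g (\<lambda>i. x (\<psi> i)) \<partial>iid_PiM M)
    = (\<integral>x. f (\<lambda>i. x (\<phi> i)) \<partial>iid_PiM M) * (\<integral>x. g (\<lambda>i. x (\<psi> i)) \<partial>iid_PiM M)"
    by (rule P.indep_var_lebesgue_integral)
      (rule P.integrable_bounded[OF measurable_compose_reindex[OF f(1)] f(2)]
        P.integrable_bounded[OF measurable_compose_reindex[OF g(1)] g(2)])+
  then show ?thesis
    by (simp only: integral_reindex[OF \<phi>(1) f(1)] integral_reindex[OF \<phi>(2) g(1)])
qed


text \<open>Coordinates \<open>(i, False)\<close> and \<open>(i, True)\<close> form two independent sequences; as \<open>m\<close> grows, \<open>g\<close> reads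
  the second one instead of the one read by \<open>f\<close>.\<close>

lemma integral_tail_limit:
  fixes f g :: "(nat \<Rightarrow> 'a) \<Rightarrow> real"
  assumes f: "f \<in> borel_measurable (iid_PiM M)" "\<And>x. \<bar>f x\<bar> \<le> C"
    and g: "g \<in> borel_measurable (iid_PiM M)" "\<And>x. \<bar>g x\<bar> \<le> C'"
  shows "(\<lambda>m. \<integral>x. f (\<lambda>i. x (i, False)) * g (\<lambda>i. x (i, i < m)) \<partial>iid_PiM M)
    \<longlonglongrightarrow> (\<integral>x. f x \<partial>iid_PiM M) * (\<integral>x. g x \<partial>iid_PiM M)"
proof -
  interpret P: prob_space "iid_PiM M :: (nat \<Rightarrow> 'a) measure" by (rule prob_space_iid)
  interpret Q: prob_space "iid_PiM M :: (nat \<times> bool \<Rightarrow> 'a) measure" by (rule prob_space_iid)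
  let ?P = "iid_PiM M :: (nat \<Rightarrow> 'a) measure"
  let ?Q = "iid_PiM M :: (nat \<times> bool \<Rightarrow> 'a) measure"
  define T where "T u m = (\<integral>x. u (\<lambda>i. x (i, False)) * g (\<lambda>i. x (i, i < m)) \<partial>?Q)" for u m
  \<comment> \<open>The claim as a property of \<open>u\<close>, with \<open>g\<close> fixed. It
    passes from cylinder sets to measurable sets by a Dynkin argument, and to integrable functions
    by linearity and dominated limits.\<close>
  define good where "good u \<longleftrightarrow> integrable ?P u \<and> T u \<longlonglongrightarrow> (\<integral>x. u x \<partial>?P) * (\<integral>x. g x \<partial>?P)" for u
  have inj: "inj (\<lambda>i::nat. (i, False))" "inj (\<lambda>i::nat. (i, i < m))" "inj (\<lambda>i::nat. (i, \<not> i < m))" for m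
    by (auto simp: inj_def)
  have int_re: "integrable ?Q (\<lambda>x. u (\<lambda>i. x (\<phi> i)))" if "integrable ?P u" "inj \<phi>" for u :: "_ \<Rightarrow> real" and \<phi>
    using integrable_distr[OF measurable_reindex, of M \<phi> u] distr_reindex[OF that(2)] that(1) by simp
  have g_re: "(\<lambda>x. g (\<lambda>i. x (i, i < m))) \<in> borel_measurable ?Q" for m
    by (rule measurable_compose_reindex[OF g(1)])
  have C'0: "0 \<le> C'" using g(2) by (meson abs_ge_zero order_trans)
  have int_T: "integrable ?Q (\<lambda>x. u (\<lambda>i. x (i, False)) * g (\<lambda>i. x (i, i < m)))"
    if "integrable ?P u" for u m
  proof (rule Bochner_Integration.integrable_bound)
    show "integrable ?Q (\<lambda>x. C' * u (\<lambda>i. x (i, False)))"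
      using int_re[OF that inj(1)] by simp
    show "AE x in ?Q. norm (u (\<lambda>i. x (i, False)) * g (\<lambda>i. x (i, i < m))) \<le> norm (C' * u (\<lambda>i. x (i, False)))"
    proof (rule AE_I2)
      fix x :: "nat \<times> bool \<Rightarrow> 'a"
      have "\<bar>g (\<lambda>i. x (i, i < m))\<bar> * \<bar>u (\<lambda>i. x (i, False))\<bar> \<le> C' * \<bar>u (\<lambda>i. x (i, False))\<bar>"
        by (rule mult_right_mono[OF g(2)]) simp
      then show "norm (u (\<lambda>i. x (i, False)) * g (\<lambda>i. x (i, i < m))) \<le> norm (C' * u (\<lambda>i. x (i, False)))"
        using C'0 by (simp add: abs_mult mult.commute)
    qed
  qed (use int_re[OF that inj(1)] g_re in measurable)
  \<comment> \<open>The bound is uniform in \<open>m\<close>; this lets an approximation of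
    \<open>u\<close> in mean be exchanged with the limit in \<open>m\<close>.\<close>
  have T_bound: "\<bar>T u m\<bar> \<le> C' * (\<integral>x. \<bar>u x\<bar> \<partial>?P)" if "integrable ?P u" for u m
  proof -
    have "\<bar>T u m\<bar> \<le> (\<integral>x. \<bar>u (\<lambda>i. x (i, False)) * g (\<lambda>i. x (i, i < m))\<bar> \<partial>?Q)"
      unfolding T_def by (rule integral_abs_bound)
    also have "\<dots> \<le> (\<integral>x. C' * \<bar>u (\<lambda>i. x (i, False))\<bar> \<partial>?Q)"
    proof (rule integral_mono)
      show "\<bar>u (\<lambda>i. x (i, False)) * g (\<lambda>i. x (i, i < m))\<bar> \<le> C' * \<bar>u (\<lambda>i. x (i, False))\<bar>" for x
        using mult_left_mono[OF g(2)[of "\<lambda>i. x (i, i < m)"] abs_ge_zero[of "u (\<lambda>i. x (i, False))"]]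
        by (simp add: abs_mult mult.commute)
    qed (use int_T[OF that] int_re[OF that inj(1)] in auto)
    also have "\<dots> = C' * (\<integral>x. \<bar>u x\<bar> \<partial>?P)"
      using integral_reindex[OF inj(1), of "\<lambda>x. \<bar>u x\<bar>"] that by simp
    finally show ?thesis .
  qed
  have T_lin: "T (\<lambda>x. a * u x + b * v x) m = a * T u m + b * T v m"
    if "integrable ?P u" "integrable ?P v" for u v a b m
    unfolding T_def using int_T[OF that(1)] int_T[OF that(2)]
    by (simp add: distrib_right mult.assoc)
  have good_lin: "good (\<lambda>x. a * u x + b * v x)" if "good u" "good v" for u v a b
  proof -
    have "T (\<lambda>x. a * u x + b * v x) = (\<lambda>m. a * T u m + b * T v m)"
      using that by (intro ext T_lin) (auto simp: good_def)
    moreover have "(\<lambda>m. a * T u m + b * T v m) \<longlonglongrightarrow>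
        a * ((\<integral>x. u x \<partial>?P) * (\<integral>x. g x \<partial>?P)) + b * ((\<integral>x. v x \<partial>?P) * (\<integral>x. g x \<partial>?P))"
      using that by (intro tendsto_intros) (auto simp: good_def)
    ultimately show ?thesis
      using that by (simp add: good_def algebra_simps)
  qed
  have good_cong: "good u" if "good v" "\<And>x. x \<in> space ?P \<Longrightarrow> u x = v x" for u v
  proof -
    have "T u = T v"
      unfolding T_def
    proof (intro ext Bochner_Integration.integral_cong refl)
      fix x m assume "x \<in> space ?Q"
      then have "(\<lambda>i. x (i, False)) \<in> space ?P" by (auto simp: space_PiM)
      from that(2)[OF this]
      show "u (\<lambda>i. x (i, False)) * g (\<lambda>i. x (i, i < m)) = v (\<lambda>i. x (i, False)) * g (\<lambda>i. x (i, i < m))"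
        by simp
    qed
    moreover have "integrable ?P u = integrable ?P v" "(\<integral>x. u x \<partial>?P) = (\<integral>x. v x \<partial>?P)"
      using that(2) by (auto intro!: Bochner_Integration.integrable_cong Bochner_Integration.integral_cong)
    ultimately show ?thesis using that(1) by (simp add: good_def)
  qed
  have good_lim: "good u" if s: "\<And>i. good (s i)" and u: "integrable ?P u"
    and lim: "\<And>x. x \<in> space ?P \<Longrightarrow> (\<lambda>i. s i x) \<longlonglongrightarrow> u x"
    and v: "integrable ?P v" "\<And>i x. x \<in> space ?P \<Longrightarrow> \<bar>s i x\<bar> \<le> v x" for u v and s :: "nat \<Rightarrow> _"
  proof -
    have si: "integrable ?P (s i)" for i using s by (simp add: good_def)
    have "(\<lambda>i. \<integral>x. \<bar>s i x - u x\<bar> \<partial>?P) \<longlonglongrightarrow> (\<integral>x. 0 \<partial>?P)"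
    proof (rule integral_dominated_convergence[where w="\<lambda>x. v x + \<bar>u x\<bar>"])
      show "AE x in ?P. (\<lambda>i. \<bar>s i x - u x\<bar>) \<longlonglongrightarrow> 0"
        using lim by (auto intro!: tendsto_rabs_zero LIM_zero)
      show "AE x in ?P. norm \<bar>s i x - u x\<bar> \<le> v x + \<bar>u x\<bar>" for i
        using v(2)[of _ i] by (auto intro!: order_trans[OF abs_triangle_ineq4])
    qed (use si u v in auto)
    then have L1: "(\<lambda>i. \<integral>x. \<bar>s i x - u x\<bar> \<partial>?P) \<longlonglongrightarrow> 0" by simp
    define G where "G = (\<integral>x. g x \<partial>?P)"
    have G: "\<bar>G\<bar> \<le> C'" unfolding G_def by (rule P.abs_integral_le_const[OF g])
    have "T u \<longlonglongrightarrow> (\<integral>x. u x \<partial>?P) * G"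
    proof (rule LIMSEQ_I)
      fix e :: real assume "e > 0"
      then have "e / (3 * (C' + 1)) > 0" using C'0 by auto
      from LIMSEQ_D[OF L1 this] obtain i where "(\<integral>x. \<bar>s i x - u x\<bar> \<partial>?P) < e / (3 * (C' + 1))"
        by auto
      then have i: "(C' + 1) * (\<integral>x. \<bar>s i x - u x\<bar> \<partial>?P) < e / 3"
        using C'0 by (simp add: field_simps)
      have i': "C' * (\<integral>x. \<bar>s i x - u x\<bar> \<partial>?P) < e / 3"
        by (rule le_less_trans[OF _ i]) (intro mult_right_mono, auto)
      have "T (s i) \<longlonglongrightarrow> (\<integral>x. s i x \<partial>?P) * G" using s unfolding good_def G_def by simp
      from LIMSEQ_D[OF this, of "e / 3"] \<open>e > 0\<close> obtain m0
        where m0: "\<And>m. m \<ge> m0 \<Longrightarrow> \<bar>T (s i) m - (\<integral>x. s i x \<partial>?P) * G\<bar> < e / 3" by auto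
      show "\<exists>m0. \<forall>m\<ge>m0. norm (T u m - (\<integral>x. u x \<partial>?P) * G) < e"
      proof (intro exI allI impI)
        fix m assume "m \<ge> m0"
        have "T (\<lambda>x. s i x - u x) m = T (s i) m - T u m"
          using T_lin[OF si[of i] u, of 1 "-1"] by simp
        then have 1: "\<bar>T (s i) m - T u m\<bar> < e / 3"
          using T_bound[of "\<lambda>x. s i x - u x" m] si u i' by simp
        have "\<bar>(\<integral>x. s i x \<partial>?P) * G - (\<integral>x. u x \<partial>?P) * G\<bar> = \<bar>G\<bar> * \<bar>\<integral>x. s i x - u x \<partial>?P\<bar>"
          using si u by (simp add: left_diff_distrib[symmetric] abs_mult)
        also have "\<dots> \<le> C' * (\<integral>x. \<bar>s i x - u x\<bar> \<partial>?P)"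
          using G C'0 by (intro mult_mono integral_abs_bound) auto
        finally have 2: "\<bar>(\<integral>x. s i x \<partial>?P) * G - (\<integral>x. u x \<partial>?P) * G\<bar> < e / 3" using i' by simp
        show "norm (T u m - (\<integral>x. u x \<partial>?P) * G) < e"
          using 1 2 m0[OF \<open>m \<ge> m0\<close>] unfolding real_norm_def by arith
      qed
    qed
    then show ?thesis using u by (simp add: good_def G_def)
  qed
  have one: "good (\<lambda>_. 1)"
  proof -
    have "T (\<lambda>_. 1) = (\<lambda>m. \<integral>x. g x \<partial>?P)"
      unfolding T_def using integral_reindex[OF inj(2) g(1)] by simp
    then show ?thesis by (simp add: good_def P.prob_space)
  qed
  have cyl: "good (indicator A)" if cylA: "A \<in> prod_algebra UNIV (\<lambda>_. M)" for A
  proof -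
    have A: "A \<in> sets ?P" using cylA unfolding sets_PiM by auto
    obtain J E where JE: "A = prod_emb UNIV (\<lambda>_. M) J (\<Pi>\<^sub>E j\<in>J. E j)" "finite J"
      using prod_algebraE[OF cylA] by metis
    obtain m0 where m0: "J \<subseteq> {..<m0}"
      using JE(2) by (metis finite_nat_iff_bounded)
    have "T (indicator A) m = (\<integral>x. indicator A x \<partial>?P) * (\<integral>x. g x \<partial>?P)" if "m \<ge> m0" for m
    proof -
      \<comment> \<open>The cylinder reads only coordinates below \<open>m0 \<le> m\<close>, where
        the flags \<open>False\<close> and \<open>\<not> i < m\<close> agree. With the second flag,
        the coordinates read by \<open>A\<close> are disjoint from those read by
        \<open>g\<close>.\<close>
      have eq: "indicator A (\<lambda>i. x (i, False)) = (indicator A (\<lambda>i. x (i, \<not> i < m)) :: real)"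
        if "x \<in> space ?Q" for x
      proof -
        have "restrict (\<lambda>i. x (i, False)) J = restrict (\<lambda>i. x (i, \<not> i < m)) J"
          using m0 \<open>m \<ge> m0\<close> by (intro ext) (auto simp: restrict_def subset_iff)
        then have "(\<lambda>i. x (i, False)) \<in> A \<longleftrightarrow> (\<lambda>i. x (i, \<not> i < m)) \<in> A"
          using that unfolding JE(1) prod_emb_def by (auto simp: space_PiM)
        then show ?thesis by (simp add: indicator_def)
      qed
      have "T (indicator A) m = (\<integral>x. indicator A (\<lambda>i. x (i, \<not> i < m)) * g (\<lambda>i. x (i, i < m)) \<partial>?Q)"
        unfolding T_def using eq by (intro Bochner_Integration.integral_cong) auto
      also have "\<dots> = (\<integral>x. indicator A x \<partial>?P) * (\<integral>x. g x \<partial>?P)"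
        by (rule integral_mult_disjoint[where C=1, OF inj(3) inj(2) _ _ _ g]) (use A in \<open>auto simp: indicator_def\<close>)
      finally show ?thesis .
    qed
    then have "T (indicator A) \<longlonglongrightarrow> (\<integral>x. indicator A x \<partial>?P) * (\<integral>x. g x \<partial>?P)"
      by (intro tendsto_eventually) (auto simp: eventually_sequentially)
    then show ?thesis
      using A by (auto simp: good_def intro!: integrable_real_indicator simp: P.emeasure_eq_measure)
  qed
  have ind: "good (indicator A)" if "A \<in> sets ?P" for A
  proof -
    have sp: "space ?P = (\<Pi>\<^sub>E i\<in>UNIV. space M)" by (simp add: space_PiM)
    have "A \<in> sigma_sets (\<Pi>\<^sub>E i\<in>UNIV. space M) (prod_algebra UNIV (\<lambda>_. M))"
      using that by (simp add: sets_PiM)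
    with Int_stable_prod_algebra prod_algebra_sets_into_space show ?thesis
    proof (induction rule: sigma_sets_induct_disjoint)
      case (basic A) then show ?case by (rule cyl)
    next
      case empty
      from good_lin[OF one one, of 0 0] show ?case by (rule good_cong) auto
    next
      case (compl A)
      from good_lin[OF one compl.IH, of 1 "-1"] show ?case
        by (rule good_cong) (auto simp: indicator_def sp)
    next
      case (union A)
      have A: "A i \<in> sets ?P" for i using union.hyps by (auto simp: sets_PiM)
      \<comment> \<open>A countable disjoint union is reached through finite partial unions, whose
        indicators add up and are dominated by 1.\<close>
      have part: "good (indicator (\<Union>i<k. A i))" for k :: nat
      proof (induction k)
        case 0
        from good_lin[OF one one, of 0 0] show ?case by (rule good_cong) auto
      next
        case (Suc k)
        from good_lin[OF Suc union.IH, of 1 1] show ?case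
        proof (rule good_cong)
          fix x
          have "A i \<inter> A k = {}" if "i < k" for i
            using disjoint_family_onD[OF union.hyps(1), of i k] that by simp
          then have "x \<notin> A i \<or> x \<notin> A k" if "i < k" for i
            using that by blast
          then show "indicator (\<Union>i<Suc k. A i) x = 1 * indicator (\<Union>i<k. A i) x + 1 * (indicator (A k) x :: real)"
            by (auto simp: indicator_def lessThan_Suc)
        qed
      qed
      show ?case
      proof (rule good_lim[OF part])
        show "integrable ?P (indicator (\<Union> (range A)) :: _ \<Rightarrow> real)"
          using A by (intro integrable_real_indicator) (auto simp: P.emeasure_eq_measure)
        show "integrable ?P (\<lambda>_. 1 :: real)" by simp
        show "(\<lambda>k. indicator (\<Union>i<k. A i) x) \<longlonglongrightarrow> (indicator (\<Union> (range A)) x :: real)" for x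
          by (rule LIMSEQ_indicator_UN)
      qed (auto simp: indicator_def)
    qed
  qed
  have "good u" if "integrable ?P u" for u
    using that
  proof (induction rule: integrable_induct)
    case (base A c)
    from good_lin[OF ind[OF base(1)] one, of c 0] show ?case
      by (rule good_cong) auto
  next
    case (add u v)
    from good_lin[OF add.IH, of 1 1] show ?case by (rule good_cong) auto
  next
    case (lim u s)
    show ?case
      by (rule good_lim[of s u "\<lambda>x. 2 * \<bar>u x\<bar>"]) (use lim in auto)
  qed
  with P.integrable_bounded[OF f] show ?thesis
    unfolding good_def T_def by blast
qed

end

subsection \<open>Influences and covariances\<close>

text \<open>Index \<open>None\<close> carries the independent copy that replaces coordinate \<open>i\<close>.\<close>

definition influence :: "'e measure \<Rightarrow> ((nat \<Rightarrow> 'e) \<Rightarrow> real) \<Rightarrow> nat \<Rightarrow> real" where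
  "influence D f i = L2norm (iid_PiM D :: (nat option \<Rightarrow> 'e) measure)
     (\<lambda>x. f (\<lambda>k. x (Some k)) - f (\<lambda>k. x (if k = i then None else Some k)))"

lemma influence_nonneg [simp]: "0 \<le> influence D f i"
  by (simp add: influence_def)

context prob_space
begin

lemma L2norm_reindex:
  assumes "inj \<phi>" "f \<in> borel_measurable (iid_PiM M)"
  shows "L2norm (iid_PiM M) (\<lambda>x. f (\<lambda>i. x (\<phi> i))) = L2norm (iid_PiM M) f"
proof -
  have "(\<lambda>x. (f x)\<^sup>2) \<in> borel_measurable (iid_PiM M)" using assms(2) by simp
  from integral_reindex[OF assms(1) this] show ?thesis unfolding L2norm_def by (rule arg_cong)
qed

text \<open>The replacing copy may sit at any free index. This identifies the influence with
  increments in other couplings: the copy is \<open>(i, True)\<close> in the covariance bound and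
  \<open>e0s\<close> for the process.\<close>

lemma influence_reindex:
  fixes \<psi> :: "nat option \<Rightarrow> 'j"
  assumes "inj \<psi>" "f \<in> borel_measurable (iid_PiM M)"
  shows "L2norm (iid_PiM M :: ('j \<Rightarrow> 'a) measure)
     (\<lambda>x. f (\<lambda>k. x (\<psi> (Some k))) - f (\<lambda>k. x (\<psi> (if k = i then None else Some k)))) = influence M f i"
proof -
  have "(\<lambda>x. f (\<lambda>k. x (Some k)) - f (\<lambda>k. x (if k = i then None else Some k)))
      \<in> borel_measurable (iid_PiM M)"
    by (intro borel_measurable_diff measurable_compose_reindex[OF assms(2)])
  from L2norm_reindex[OF assms(1) this] show ?thesis
    unfolding influence_def .
qed

text \<open>Telescoping in \<open>m\<close> leads from \<open>g\<close> reading the same sequence as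
  \<open>f\<close> to \<open>g\<close> reading an independent one, and the \<open>i\<close>-th step
  changes coordinate \<open>i\<close> only. The factor 1/2 comes from the symmetrization that turns
  \<open>f\<close> into its own increment.\<close>

lemma covariance_le_influence:
  fixes f g :: "(nat \<Rightarrow> 'a) \<Rightarrow> real"
  assumes f: "f \<in> borel_measurable (iid_PiM M)" "\<And>x. \<bar>f x\<bar> \<le> C"
    and g: "g \<in> borel_measurable (iid_PiM M)" "\<And>x. \<bar>g x\<bar> \<le> C'"
    and summ: "summable (\<lambda>i. influence M f i * influence M g i)"
  shows "\<bar>(\<integral>x. f x * g x \<partial>iid_PiM M) - (\<integral>x. f x \<partial>iid_PiM M) * (\<integral>x. g x \<partial>iid_PiM M)\<bar>
    \<le> (\<Sum>i. influence M f i * influence M g i) / 2"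
proof -
  let ?Q = "iid_PiM M :: (nat \<times> bool \<Rightarrow> 'a) measure"
  interpret Q: prob_space ?Q by (rule prob_space_iid)
  define F where "F = (\<lambda>x :: nat \<times> bool \<Rightarrow> 'a. f (\<lambda>k. x (k, False)))"
  define Fi where "Fi i = (\<lambda>x :: nat \<times> bool \<Rightarrow> 'a. f (\<lambda>k. x (k, k = i)))" for i
  \<comment> \<open>No flag is set for \<open>m = 0\<close>, so \<open>G 0\<close> reads the same
    sequence as \<open>F\<close>; \<open>G m\<close> reads the second sequence in the coordinates
    below \<open>m\<close>.\<close>
  define G where "G m = (\<lambda>x :: nat \<times> bool \<Rightarrow> 'a. g (\<lambda>k. x (k, k < m)))" for m
  have [measurable]: "F \<in> borel_measurable ?Q" "Fi i \<in> borel_measurable ?Q" "G m \<in> borel_measurable ?Q" for i m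
    unfolding F_def Fi_def G_def by (rule measurable_compose_reindex[OF f(1)] measurable_compose_reindex[OF g(1)])+
  have bnd: "\<bar>F x\<bar> \<le> C" "\<bar>Fi i x\<bar> \<le> C" "\<bar>G m x\<bar> \<le> C'" for i m x
    unfolding F_def Fi_def G_def by (rule f g)+
  have int_mult: "integrable ?Q (\<lambda>x. u x * v x)"
    if "u \<in> borel_measurable ?Q" "v \<in> borel_measurable ?Q" "\<And>x. \<bar>u x\<bar> \<le> c" "\<And>x. \<bar>v x\<bar> \<le> c'" for u v :: "_ \<Rightarrow> real" and c c'
  proof (rule Q.integrable_bounded)
    have "0 \<le> c" using that(3) by (meson abs_ge_zero order_trans)
    then show "\<bar>u x * v x\<bar> \<le> c * c'" for x
      using that(3,4) by (simp add: abs_mult mult_mono)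
  qed (use that in measurable)
  \<comment> \<open>The law is invariant under exchanging \<open>x (i, False)\<close> and \<open>x (i, True)\<close>, which flips the sign of
    the increment of \<open>g\<close>; averaging both forms replaces \<open>f\<close> by its own increment at \<open>i\<close>.\<close>
  have step: "\<bar>(\<integral>x. F x * G i x \<partial>?Q) - (\<integral>x. F x * G (Suc i) x \<partial>?Q)\<bar>
      \<le> influence M f i * influence M g i / 2" for i
  proof -
    define \<sigma> where "\<sigma> = (\<lambda>p :: nat \<times> bool. if fst p = i then (i, \<not> snd p) else p)"
    have "inj \<sigma>" by (auto simp: inj_def \<sigma>_def split: if_splits)
    have "(\<integral>x. F x * (G i x - G (Suc i) x) \<partial>?Q)
        = (\<integral>x. F (\<lambda>p. x (\<sigma> p)) * (G i (\<lambda>p. x (\<sigma> p)) - G (Suc i) (\<lambda>p. x (\<sigma> p))) \<partial>?Q)"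
      by (rule integral_reindex[OF \<open>inj \<sigma>\<close>, of "\<lambda>x. F x * (G i x - G (Suc i) x)", symmetric]) measurable
    also have "(\<lambda>x. F (\<lambda>p. x (\<sigma> p)) * (G i (\<lambda>p. x (\<sigma> p)) - G (Suc i) (\<lambda>p. x (\<sigma> p))))
        = (\<lambda>x. Fi i x * (G (Suc i) x - G i x))"
    proof
      fix x :: "nat \<times> bool \<Rightarrow> 'a"
      have "(\<lambda>k. x (\<sigma> (k, False))) = (\<lambda>k. x (k, k = i))"
        "(\<lambda>k. x (\<sigma> (k, k < i))) = (\<lambda>k. x (k, k < Suc i))"
        "(\<lambda>k. x (\<sigma> (k, k < Suc i))) = (\<lambda>k. x (k, k < i))"
        by (auto simp: \<sigma>_def fun_eq_iff less_Suc_eq)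
      then show "F (\<lambda>p. x (\<sigma> p)) * (G i (\<lambda>p. x (\<sigma> p)) - G (Suc i) (\<lambda>p. x (\<sigma> p)))
          = Fi i x * (G (Suc i) x - G i x)"
        by (simp add: F_def Fi_def G_def)
    qed
    finally have swap: "(\<integral>x. F x * (G i x - G (Suc i) x) \<partial>?Q) = (\<integral>x. Fi i x * (G (Suc i) x - G i x) \<partial>?Q)" .
    have bG: "\<bar>G i x - G (Suc i) x\<bar> \<le> 2 * C'" "\<bar>G (Suc i) x - G i x\<bar> \<le> 2 * C'" "\<bar>F x - Fi i x\<bar> \<le> 2 * C" for x
      using bnd(3)[of i x] bnd(3)[of "Suc i" x] bnd(1)[of x] bnd(2)[of i x] by linarith+
    have "2 * (\<integral>x. F x * (G i x - G (Suc i) x) \<partial>?Q)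
        = (\<integral>x. F x * (G i x - G (Suc i) x) \<partial>?Q) + (\<integral>x. Fi i x * (G (Suc i) x - G i x) \<partial>?Q)"
      using swap by simp
    also have "\<dots> = (\<integral>x. F x * (G i x - G (Suc i) x) + Fi i x * (G (Suc i) x - G i x) \<partial>?Q)"
      by (intro Bochner_Integration.integral_add[symmetric] int_mult[OF _ _ bnd(1) bG(1)] int_mult[OF _ _ bnd(2) bG(2)]) auto
    also have "\<dots> = (\<integral>x. (F x - Fi i x) * (G i x - G (Suc i) x) \<partial>?Q)"
      by (simp add: algebra_simps)
    also have "\<bar>\<dots>\<bar> \<le> L2norm ?Q (\<lambda>x. F x - Fi i x) * L2norm ?Q (\<lambda>x. G i x - G (Suc i) x)"
      unfolding power2_eq_square[symmetric]
      by (rule Cauchy_Schwarz_integral)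
        (unfold power2_eq_square, auto intro!: int_mult[OF _ _ bG(3) bG(3)] int_mult[OF _ _ bG(1) bG(1)] int_mult[OF _ _ bG(3) bG(1)])
    also have "L2norm ?Q (\<lambda>x. F x - Fi i x) = influence M f i"
    proof -
      define \<psi> where "\<psi> = (\<lambda>y. case y of None \<Rightarrow> (i, True) | Some k \<Rightarrow> (k, False))"
      have "inj \<psi>" by (auto simp: inj_def \<psi>_def split: option.splits)
      have "(\<lambda>k. x (k, k = i)) = (\<lambda>k. x (\<psi> (if k = i then None else Some k)))" for x :: "nat \<times> bool \<Rightarrow> 'a"
        by (auto simp: \<psi>_def fun_eq_iff)
      then show ?thesis
        using influence_reindex[OF \<open>inj \<psi>\<close> f(1), of i] by (simp add: F_def Fi_def \<psi>_def)
    qed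
    also have "L2norm ?Q (\<lambda>x. G i x - G (Suc i) x) = influence M g i"
    proof -
      \<comment> \<open>Coordinates below \<open>i\<close> have already been switched, so the base
        point of this increment is \<open>G i\<close> and replacing coordinate \<open>i\<close>
        gives \<open>G (Suc i)\<close>.\<close>
      define \<psi> where "\<psi> = (\<lambda>y. case y of None \<Rightarrow> (i, True) | Some k \<Rightarrow> (k, k < i))"
      have "inj \<psi>" by (auto simp: inj_def \<psi>_def split: option.splits)
      have "(\<lambda>k. x (k, k < Suc i)) = (\<lambda>k. x (\<psi> (if k = i then None else Some k)))" for x :: "nat \<times> bool \<Rightarrow> 'a"
        by (auto simp: \<psi>_def fun_eq_iff less_Suc_eq)
      then show ?thesis
        using influence_reindex[OF \<open>inj \<psi>\<close> g(1), of i] by (simp add: G_def \<psi>_def)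
    qed
    finally have "2 * \<bar>\<integral>x. F x * (G i x - G (Suc i) x) \<partial>?Q\<bar> \<le> influence M f i * influence M g i"
      by simp
    moreover have "(\<integral>x. F x * (G i x - G (Suc i) x) \<partial>?Q) = (\<integral>x. F x * G i x \<partial>?Q) - (\<integral>x. F x * G (Suc i) x \<partial>?Q)"
      unfolding right_diff_distrib
      by (intro Bochner_Integration.integral_diff int_mult[OF _ _ bnd(1) bnd(3)]) auto
    ultimately show ?thesis by simp
  qed
  define S where "S = (\<Sum>i. influence M f i * influence M g i) / 2"
  have "\<bar>(\<integral>x. F x * G 0 x \<partial>?Q) - (\<integral>x. F x * G m x \<partial>?Q)\<bar> \<le> S" for m
  proof -
    have "(\<integral>x. F x * G 0 x \<partial>?Q) - (\<integral>x. F x * G m x \<partial>?Q)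
        = (\<Sum>i<m. (\<integral>x. F x * G i x \<partial>?Q) - (\<integral>x. F x * G (Suc i) x \<partial>?Q))"
      by (rule sum_lessThan_telescope'[symmetric])
    also have "\<bar>\<dots>\<bar> \<le> (\<Sum>i<m. influence M f i * influence M g i / 2)"
      by (rule order_trans[OF sum_abs sum_mono[OF step]])
    also have "\<dots> = (\<Sum>i<m. influence M f i * influence M g i) / 2"
      by (simp add: sum_divide_distrib)
    also have "\<dots> \<le> S"
      unfolding S_def using summ by (intro divide_right_mono sum_le_suminf) auto
    finally show ?thesis .
  qed
  moreover have "(\<lambda>m. \<integral>x. F x * G m x \<partial>?Q) \<longlonglongrightarrow> (\<integral>x. f x \<partial>iid_PiM M) * (\<integral>x. g x \<partial>iid_PiM M)"
    unfolding F_def G_def by (rule integral_tail_limit[OF f g])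
  then have "(\<lambda>m. \<bar>(\<integral>x. F x * G 0 x \<partial>?Q) - (\<integral>x. F x * G m x \<partial>?Q)\<bar>)
      \<longlonglongrightarrow> \<bar>(\<integral>x. F x * G 0 x \<partial>?Q) - (\<integral>x. f x \<partial>iid_PiM M) * (\<integral>x. g x \<partial>iid_PiM M)\<bar>"
    by (intro tendsto_intros)
  ultimately have "\<bar>(\<integral>x. F x * G 0 x \<partial>?Q) - (\<integral>x. f x \<partial>iid_PiM M) * (\<integral>x. g x \<partial>iid_PiM M)\<bar> \<le> S"
    by (intro LIMSEQ_le_const2) auto
  moreover have "(\<integral>x. F x * G 0 x \<partial>?Q) = (\<integral>x. f x * g x \<partial>iid_PiM M)"
  proof -
    have "(\<lambda>x. f x * g x) \<in> borel_measurable (iid_PiM M)" using f g by simp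
    moreover have "inj (\<lambda>k::nat. (k, False))" by (simp add: inj_def)
    ultimately show ?thesis
      unfolding F_def G_def by (subst integral_reindex[symmetric]) auto
  qed
  ultimately show ?thesis by (simp add: S_def)
qed

end

section \<open>Influences of shifts and products, autocovariances and variances of sums\<close>

lemma abs_mult_diff_le:
  fixes a b a' b' :: real
  assumes "\<bar>a\<bar> \<le> 1" "\<bar>b'\<bar> \<le> 1"
  shows "\<bar>a * b - a' * b'\<bar> \<le> \<bar>a - a'\<bar> + \<bar>b - b'\<bar>"
proof -
  have "a * b - a' * b' = a * (b - b') + (a - a') * b'" by (simp add: algebra_simps)
  also have "\<bar>\<dots>\<bar> \<le> \<bar>a\<bar> * \<bar>b - b'\<bar> + \<bar>a - a'\<bar> * \<bar>b'\<bar>"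
    unfolding abs_mult[symmetric] by (rule abs_triangle_ineq)
  also have "\<dots> \<le> 1 * \<bar>b - b'\<bar> + \<bar>a - a'\<bar> * 1"
    using assms by (intro add_mono mult_mono) auto
  finally show ?thesis by simp
qed

text \<open>Splitting at zero makes \<open>nat \<bar>j\<bar>\<close> injective on each half, hence
  the factor 2.\<close>

lemma sum_nat_abs_le:
  fixes c :: "nat \<Rightarrow> real"
  assumes "summable c" "\<And>k. 0 \<le> c k" "finite F"
  shows "(\<Sum>j\<in>F. c (nat \<bar>j\<bar>)) \<le> 2 * (\<Sum>k. c k)"
proof -
  have half: "(\<Sum>j\<in>U. c (nat \<bar>j\<bar>)) \<le> (\<Sum>k. c k)"
    if "finite U" "inj_on (\<lambda>j. nat \<bar>j\<bar>) U" for U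
  proof -
    have "(\<Sum>j\<in>U. c (nat \<bar>j\<bar>)) = sum c ((\<lambda>j. nat \<bar>j\<bar>) ` U)"
      using that(2) by (simp add: sum.reindex)
    also have "\<dots> \<le> (\<Sum>k. c k)" using that(1) assms by (intro sum_le_suminf) auto
    finally show ?thesis .
  qed
  have "(\<Sum>j\<in>F. c (nat \<bar>j\<bar>)) = (\<Sum>j\<in>{j\<in>F. j \<le> 0}. c (nat \<bar>j\<bar>)) + (\<Sum>j\<in>{j\<in>F. \<not> j \<le> 0}. c (nat \<bar>j\<bar>))"
    using assms(3) by (subst sum.union_disjoint[symmetric]) (auto intro!: sum.cong)
  also have "\<dots> \<le> (\<Sum>k. c k) + (\<Sum>k. c k)"
    using assms(3) by (intro add_mono half) (auto simp: inj_on_def)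
  finally show ?thesis by simp
qed

context prob_space
begin

lemma inj_add_nat: "inj (\<lambda>k::nat. k + h)"
  by (simp add: inj_def)

text \<open>After the shift the coordinates below \<open>h\<close> are no longer read, which gives
  the zero branch. This offset turns the covariance bound into a convolution in the lag.\<close>

lemma influence_shift:
  assumes f: "f \<in> borel_measurable (iid_PiM M)"
  shows "influence M (\<lambda>x. f (\<lambda>k. x (k + h))) i = (if h \<le> i then influence M f (i - h) else 0)"
proof (cases "h \<le> i")
  case True
  define \<psi> where "\<psi> = map_option (\<lambda>k::nat. k + h)"
  have "inj \<psi>" unfolding \<psi>_def by (rule option.inj_map[OF inj_add_nat])
  moreover have "\<psi> (if k = i - h then None else Some k) = (if k + h = i then None else Some (k + h))"
    "\<psi> (Some k) = Some (k + h)" for k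
    using True by (auto simp: \<psi>_def)
  ultimately show ?thesis
    using influence_reindex[OF _ f, of \<psi> "i - h"] True by (simp only: influence_def if_True)
next
  case False
  then have "(\<lambda>k. x (if k + h = i then None else Some (k + h))) = (\<lambda>k. x (Some (k + h)))"
    for x :: "nat option \<Rightarrow> 'a" by auto
  with False show ?thesis by (simp add: influence_def L2norm_def)
qed

text \<open>The product rule for increments of functionals bounded by 1, followed by the triangle
  inequality. It controls products of scores at two times.\<close>

lemma influence_mult_le:
  assumes f: "f \<in> borel_measurable (iid_PiM M)" "\<And>x. \<bar>f x\<bar> \<le> 1"
    and g: "g \<in> borel_measurable (iid_PiM M)" "\<And>x. \<bar>g x\<bar> \<le> 1"
  shows "influence M (\<lambda>x. f x * g x) i \<le> influence M f i + influence M g i"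
proof -
  let ?Q = "iid_PiM M :: (nat option \<Rightarrow> 'a) measure"
  interpret Q: prob_space ?Q by (rule prob_space_iid)
  define df where "df = (\<lambda>x. f (\<lambda>k. x (Some k)) - f (\<lambda>k. x (if k = i then None else Some k)))"
  define dg where "dg = (\<lambda>x. g (\<lambda>k. x (Some k)) - g (\<lambda>k. x (if k = i then None else Some k)))"
  have meas: "(\<lambda>x. u (\<lambda>k. x (Some k))) \<in> borel_measurable ?Q"
    "(\<lambda>x. u (\<lambda>k. x (if k = i then None else Some k))) \<in> borel_measurable ?Q"
    if "u \<in> borel_measurable (iid_PiM M)" for u :: "(nat \<Rightarrow> 'a) \<Rightarrow> real"
    by (rule measurable_compose_reindex[OF that])+
  have [measurable]: "df \<in> borel_measurable ?Q" "dg \<in> borel_measurable ?Q"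
    unfolding df_def dg_def by (intro borel_measurable_diff meas f g)+
  have bnd: "\<bar>df x\<bar> \<le> 2" "\<bar>dg x\<bar> \<le> 2" for x
    using f(2)[of "\<lambda>k. x (Some k)"] f(2)[of "\<lambda>k. x (if k = i then None else Some k)"]
      g(2)[of "\<lambda>k. x (Some k)"] g(2)[of "\<lambda>k. x (if k = i then None else Some k)"]
    unfolding df_def dg_def by linarith+
  have int: "integrable ?Q (\<lambda>x. u x * v x)"
    if "u \<in> borel_measurable ?Q" "v \<in> borel_measurable ?Q" "\<And>x. \<bar>u x\<bar> \<le> 4" "\<And>x. \<bar>v x\<bar> \<le> 4"
    for u v :: "_ \<Rightarrow> real"
  proof (rule Q.integrable_bounded)
    show "\<bar>u x * v x\<bar> \<le> 4 * 4" for x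
      unfolding abs_mult using that(3,4) by (intro mult_mono) auto
  qed (use that in measurable)
  have bnd4: "\<bar>\<bar>df x\<bar>\<bar> \<le> 4" "\<bar>\<bar>dg x\<bar>\<bar> \<le> 4" "\<bar>\<bar>df x\<bar> + \<bar>dg x\<bar>\<bar> \<le> 4" for x
    using bnd[of x] by auto
  have "influence M (\<lambda>x. f x * g x) i \<le> L2norm ?Q (\<lambda>x. \<bar>df x\<bar> + \<bar>dg x\<bar>)"
    unfolding influence_def
  proof (rule L2norm_mono)
    fix x :: "nat option \<Rightarrow> 'a"
    show "\<bar>f (\<lambda>k. x (Some k)) * g (\<lambda>k. x (Some k)) -
        f (\<lambda>k. x (if k = i then None else Some k)) * g (\<lambda>k. x (if k = i then None else Some k))\<bar>
        \<le> \<bar>\<bar>df x\<bar> + \<bar>dg x\<bar>\<bar>"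
      using abs_mult_diff_le[OF f(2) g(2)] by (simp add: df_def dg_def)
  next
    show "integrable ?Q (\<lambda>x. (\<bar>df x\<bar> + \<bar>dg x\<bar>)\<^sup>2)"
      unfolding power2_eq_square by (rule int[OF _ _ bnd4(3) bnd4(3)]) measurable
  qed (intro borel_measurable_diff borel_measurable_times meas f g)
  also have "\<dots> \<le> L2norm ?Q (\<lambda>x. \<bar>df x\<bar>) + L2norm ?Q (\<lambda>x. \<bar>dg x\<bar>)"
    by (rule L2norm_triangle; (unfold power2_eq_square)?; rule int[OF _ _ bnd4(1) bnd4(1)] int[OF _ _ bnd4(2) bnd4(2)] int[OF _ _ bnd4(1) bnd4(2)]; measurable)
  also have "\<dots> = influence M f i + influence M g i"
    by (simp add: influence_def L2norm_def df_def dg_def)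
  finally show ?thesis .
qed

text \<open>Coordinates count time backwards, so the shift by \<open>h\<close> looks
  \<open>h\<close> steps into the past. Both factors have the same mean, hence the square.\<close>

definition autocov :: "((nat \<Rightarrow> 'a) \<Rightarrow> real) \<Rightarrow> nat \<Rightarrow> real" where
  "autocov z h = (\<integral>x. z x * z (\<lambda>k. x (k + h)) \<partial>iid_PiM M) - (\<integral>x. z x \<partial>iid_PiM M)\<^sup>2"

text \<open>With \<open>d\<close> the influences and \<open>s\<close> their sum, the covariance at
  lag \<open>h\<close> is at most half of \<open>\<Sum>i. d (i + h) * d i\<close>. Summing over
  \<open>h\<close> before \<open>i\<close> bounds the inner sum by \<open>s * d i\<close>, which
  leaves \<open>s\<^sup>2 / 2\<close>.\<close>

lemma autocov_summable:
  assumes z: "z \<in> borel_measurable (iid_PiM M)" "\<And>x. \<bar>z x\<bar> \<le> C"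
    and S: "summable (influence M z)"
  shows "summable (\<lambda>h. \<bar>autocov z h\<bar>)"
    and "(\<Sum>h. \<bar>autocov z h\<bar>) \<le> (\<Sum>i. influence M z i)\<^sup>2 / 2"
proof -
  define d where "d = influence M z"
  define s where "s = (\<Sum>i. d i)"
  have d0: "0 \<le> d i" for i by (simp add: d_def)
  have sd: "summable d" using S by (simp add: d_def)
  have part: "(\<Sum>h<H. d (i + h)) \<le> s" for i H
  proof -
    have "(\<Sum>h<H. d (i + h)) = sum d ((\<lambda>h. i + h) ` {..<H})"
      by (subst sum.reindex) (auto simp: inj_on_def)
    also have "\<dots> \<le> s" unfolding s_def using sd d0 by (intro sum_le_suminf) auto
    finally show ?thesis .
  qed
  have le_s: "d i \<le> s" for i using part[of i 1] by simp
  have summ: "summable (\<lambda>i. d (i + h) * d i)" for h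
    by (rule summable_comparison_test'[OF summable_mult[OF sd, of s], of 0])
      (use d0 le_s in \<open>auto simp: mult_right_mono abs_mult\<close>)
  have bound: "\<bar>autocov z h\<bar> \<le> (\<Sum>i. d (i + h) * d i) / 2" for h
  proof -
    have inf: "influence M (\<lambda>x. z (\<lambda>k. x (k + h))) i = (if h \<le> i then d (i - h) else 0)" for i
      unfolding d_def by (rule influence_shift[OF z(1)])
    have summ': "summable (\<lambda>i. d i * (if h \<le> i then d (i - h) else 0))"
      by (subst summable_iff_shift[symmetric, of _ h]) (use summ[of h] in simp)
    have "(\<Sum>i. d i * (if h \<le> i then d (i - h) else 0)) = (\<Sum>i. d (i + h) * d i)"
      using suminf_split_initial_segment[OF summ', of h] by simp
    moreover have "(\<integral>x. z (\<lambda>k. x (k + h)) \<partial>iid_PiM M) = (\<integral>x. z x \<partial>iid_PiM M)"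
      by (rule integral_reindex[OF inj_add_nat z(1)])
    ultimately show ?thesis
      using covariance_le_influence[OF z measurable_compose_reindex[OF z(1)] z(2), of "\<lambda>k. k + h"] summ'
      unfolding autocov_def by (simp add: inf d_def[symmetric] power2_eq_square)
  qed
  have psum: "(\<Sum>h<H. \<bar>autocov z h\<bar>) \<le> s\<^sup>2 / 2" for H
  proof -
    have "(\<Sum>h<H. \<bar>autocov z h\<bar>) \<le> (\<Sum>h<H. (\<Sum>i. d (i + h) * d i) / 2)"
      by (intro sum_mono bound)
    also have "\<dots> = (\<Sum>i. \<Sum>h<H. d (i + h) * d i) / 2"
      using summ by (simp add: suminf_sum sum_divide_distrib)
    also have "\<dots> \<le> (\<Sum>i. s * d i) / 2"
    proof (intro divide_right_mono suminf_le)
      show "(\<Sum>h<H. d (i + h) * d i) \<le> s * d i" for i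
        using part[of i H] d0 by (simp add: sum_distrib_right[symmetric] mult_right_mono)
    qed (use summ sd in \<open>auto intro!: summable_sum summable_mult\<close>)
    also have "\<dots> = s\<^sup>2 / 2"
      using sd by (simp add: suminf_mult s_def power2_eq_square)
    finally show ?thesis .
  qed
  show summ_c: "summable (\<lambda>h. \<bar>autocov z h\<bar>)"
    by (rule summableI_nonneg_bounded[OF _ psum]) simp
  show "(\<Sum>h. \<bar>autocov z h\<bar>) \<le> (\<Sum>i. influence M z i)\<^sup>2 / 2"
    using suminf_le_const[OF summ_c psum] by (simp add: s_def d_def)
qed

lemma integral_stationary:
  fixes z :: "(nat \<Rightarrow> 'a) \<Rightarrow> real"
  assumes z: "z \<in> borel_measurable (iid_PiM M)"
  shows "(\<integral>x. z (\<lambda>k. x (t - int k)) \<partial>iid_PiM M) = (\<integral>x. z x \<partial>iid_PiM M)"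
  by (rule integral_reindex[OF _ z]) (simp add: inj_def)

text \<open>Counting backwards from the later of the two times turns the pair into \<open>z\<close>
  and its shift by the lag; symmetry of the product covers the other order.\<close>

lemma integral_stationary_mult:
  fixes z :: "(nat \<Rightarrow> 'a) \<Rightarrow> real"
  assumes z: "z \<in> borel_measurable (iid_PiM M)"
  shows "(\<integral>x. z (\<lambda>k. x (s - int k)) * z (\<lambda>k. x (t - int k)) \<partial>iid_PiM M)
    = autocov z (nat \<bar>t - s\<bar>) + (\<integral>x. z x \<partial>iid_PiM M)\<^sup>2"
proof -
  have le: "(\<integral>x. z (\<lambda>k. x (t - int k)) * z (\<lambda>k. x (s - int k)) \<partial>iid_PiM M)
    = autocov z (nat \<bar>t - s\<bar>) + (\<integral>x. z x \<partial>iid_PiM M)\<^sup>2" if "s \<le> t" for s t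
  proof -
    have "inj (\<lambda>k. t - int k)" by (simp add: inj_def)
    moreover have "(\<lambda>x. z x * z (\<lambda>k. x (k + nat (t - s)))) \<in> borel_measurable (iid_PiM M)"
      by (intro borel_measurable_times z measurable_compose_reindex[OF z])
    ultimately have "(\<integral>x. z (\<lambda>k. x (t - int k)) * z (\<lambda>k. x (t - int (k + nat (t - s)))) \<partial>iid_PiM M)
      = (\<integral>x. z x * z (\<lambda>k. x (k + nat (t - s))) \<partial>iid_PiM M)"
      by (rule integral_reindex)
    moreover have "t - int (k + nat (t - s)) = s - int k" for k using that by simp
    ultimately show ?thesis using that by (simp add: autocov_def)
  qed
  show ?thesis
    using le[of s t] le[of t s] by (cases "s \<le> t") (auto simp: mult.commute abs_minus_commute)
qed

text \<open>Each row of the covariance matrix sums to at most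
  \<open>2 * (\<Sum>h. \<bar>autocov z h\<bar>)\<close>; this 2, for lags of both signs, cancels the
  1/2 of the covariance bound. An arbitrary finite \<open>T\<close> covers the truncated ranges of
  \<open>r_hat\<close>.\<close>

lemma variance_sum_le:
  fixes z :: "(nat \<Rightarrow> 'a) \<Rightarrow> real" and T :: "int set"
  assumes z: "z \<in> borel_measurable (iid_PiM M)" "\<And>x. \<bar>z x\<bar> \<le> C"
    and S: "summable (influence M z)" and T: "finite T"
  shows "(\<integral>x. (\<Sum>t\<in>T. z (\<lambda>k. x (t - int k)) - (\<integral>x. z x \<partial>iid_PiM M))\<^sup>2 \<partial>iid_PiM M)
    \<le> real (card T) * (\<Sum>i. influence M z i)\<^sup>2"
proof -
  let ?Q = "iid_PiM M :: (int \<Rightarrow> 'a) measure"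
  interpret Q: prob_space ?Q by (rule prob_space_iid)
  define \<mu> where "\<mu> = (\<integral>x. z x \<partial>iid_PiM M)"
  define a where "a t = (\<lambda>x :: int \<Rightarrow> 'a. z (\<lambda>k. x (t - int k)))" for t
  note summ = autocov_summable[OF z S]
  have [measurable]: "a t \<in> borel_measurable ?Q" for t
    unfolding a_def by (rule measurable_compose_reindex[OF z(1)])
  have abnd: "\<bar>a t x\<bar> \<le> C" for t x unfolding a_def by (rule z)
  have int1: "integrable ?Q (a t)" for t
    by (rule Q.integrable_bounded[OF _ abnd]) measurable
  have int2: "integrable ?Q (\<lambda>x. a s x * a t x)" for s t
  proof (rule Q.integrable_bounded)
    have "0 \<le> C" using z(2) by (meson abs_ge_zero order_trans)
    then show "\<bar>a s x * a t x\<bar> \<le> C * C" for x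
      unfolding abs_mult by (intro mult_mono abnd) auto
  qed measurable
  have expand: "(a s x - \<mu>) * (a t x - \<mu>) = a s x * a t x - \<mu> * a s x - \<mu> * a t x + \<mu> * \<mu>" for s t x
    by (simp add: algebra_simps)
  have int3: "integrable ?Q (\<lambda>x. (a s x - \<mu>) * (a t x - \<mu>))" for s t
    unfolding expand using int1 int2 by auto
  have mean: "(\<integral>x. a t x \<partial>?Q) = \<mu>" for t
    unfolding a_def \<mu>_def by (rule integral_stationary[OF z(1)])
  have cov: "(\<integral>x. (a s x - \<mu>) * (a t x - \<mu>) \<partial>?Q) = autocov z (nat \<bar>t - s\<bar>)" for s t
  proof -
    have "(\<integral>x. (a s x - \<mu>) * (a t x - \<mu>) \<partial>?Q) = (\<integral>x. a s x * a t x \<partial>?Q) - \<mu> * \<mu> - \<mu> * \<mu> + \<mu> * \<mu>"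
      unfolding expand using int1 int2 by (simp add: mean Q.prob_space)
    also have "(\<integral>x. a s x * a t x \<partial>?Q) = autocov z (nat \<bar>t - s\<bar>) + \<mu>\<^sup>2"
      unfolding a_def \<mu>_def by (rule integral_stationary_mult[OF z(1)])
    finally show ?thesis by (simp add: power2_eq_square)
  qed
  have row: "(\<Sum>t\<in>T. autocov z (nat \<bar>t - s\<bar>)) \<le> (\<Sum>i. influence M z i)\<^sup>2" for s
  proof -
    have "(\<Sum>t\<in>T. autocov z (nat \<bar>t - s\<bar>)) \<le> (\<Sum>t\<in>T. \<bar>autocov z (nat \<bar>t - s\<bar>)\<bar>)"
      by (intro sum_mono) simp
    also have "\<dots> = (\<Sum>j\<in>(\<lambda>t. t - s) ` T. \<bar>autocov z (nat \<bar>j\<bar>)\<bar>)"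
      by (subst sum.reindex) (auto simp: inj_on_def)
    also have "\<dots> \<le> 2 * (\<Sum>h. \<bar>autocov z h\<bar>)"
      using T by (intro sum_nat_abs_le summ(1)) auto
    finally show ?thesis using summ(2) by simp
  qed
  have "(\<integral>x. (\<Sum>t\<in>T. a t x - \<mu>)\<^sup>2 \<partial>?Q) = (\<integral>x. (\<Sum>s\<in>T. \<Sum>t\<in>T. (a s x - \<mu>) * (a t x - \<mu>)) \<partial>?Q)"
    by (simp add: power2_eq_square sum_product)
  also have "\<dots> = (\<Sum>s\<in>T. \<Sum>t\<in>T. autocov z (nat \<bar>t - s\<bar>))"
    using int3 by (simp add: cov)
  also have "\<dots> \<le> (\<Sum>s\<in>T. (\<Sum>i. influence M z i)\<^sup>2)"
    by (intro sum_mono row)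
  finally show ?thesis by (simp add: a_def \<mu>_def)
qed

end

subsection \<open>Lag-window weights and sample quantiles\<close>

lemma integrable_count_space_nat_abs:
  fixes c :: "nat \<Rightarrow> real"
  assumes "summable c" "\<And>k. 0 \<le> c k"
  shows "integrable (count_space UNIV) (\<lambda>j::int. c (nat \<bar>j\<bar>))"
proof -
  have "(\<lambda>j::int. c (nat \<bar>j\<bar>)) summable_on UNIV"
    by (rule nonneg_bdd_above_summable_on)
      (use assms sum_nat_abs_le[OF assms] in \<open>auto intro!: bdd_aboveI2\<close>)
  then have "(\<lambda>j::int. norm (c (nat \<bar>j\<bar>))) summable_on UNIV"
    using assms(2) by simp
  then show ?thesis
    using abs_summable_equivalent[of "\<lambda>j::int. c (nat \<bar>j\<bar>)" UNIV] by (simp add: abs_summable_on_def)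
qed

text \<open>The series defining \<open>g_tau\<close> becomes an integral over the counting measure,
  so that dominated convergence applies over all lags.\<close>

lemma infsum_eq_integral_count_space:
  fixes f :: "'a \<Rightarrow> real"
  assumes "integrable (count_space UNIV) f"
  shows "(\<Sum>\<^sub>\<infinity>x. f x) = (\<integral>x. f x \<partial>count_space UNIV)"
  using infsetsum_infsum[of f UNIV] assms by (simp add: abs_summable_on_def infsetsum_def)

lemma in_W_bounded:
  assumes "in_W w"
  obtains K where "1 \<le> K" "\<And>x. \<bar>w x\<bar> \<le> K"
proof -
  obtain K where K: "\<And>x. \<bar>w x\<bar> \<le> K"
    using assms unfolding in_W_def bounded_iff by auto
  show thesis by (rule that[of "max 1 K"]) (use K in \<open>auto simp: le_max_iff_disj\<close>)
qed

text \<open>Boundedness of \<open>w\<close> makes the \<open>SUP\<close> in \<open>wbar\<close> a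
  true supremum.\<close>

lemma wbar_ge:
  assumes "in_W w" "x \<le> y"
  shows "\<bar>w y\<bar> \<le> wbar w x"
proof -
  obtain K where "\<And>x. \<bar>w x\<bar> \<le> K" using in_W_bounded[OF assms(1)] by metis
  then show ?thesis unfolding wbar_def using assms(2)
    by (intro cSUP_upper bdd_aboveI2[of _ _ K]) auto
qed

text \<open>A Riemann sum with mesh \<open>1 / B\<close> evaluated at right endpoints: on each cell
  \<open>wbar w\<close> dominates the value of \<open>\<bar>w\<bar>\<close> at the right endpoint,
  because it is a supremum over everything to the right.\<close>

lemma kernel_sum_nat_le:
  assumes w: "in_W w" and B: "0 < B"
  shows "(\<Sum>k<m. \<bar>w (real (Suc k) / B)\<bar>) \<le> B * (\<integral>x\<in>{0..}. wbar w x \<partial>lborel)"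
proof -
  let ?I = "\<lambda>k::nat. {real k / B<..real (Suc k) / B}"
  have int: "integrable lborel (\<lambda>x. indicator {0..} x * wbar w x)"
    using w by (simp add: in_W_def set_integrable_def)
  have nn: "0 \<le> wbar w x" for x
    using wbar_ge[OF w order_refl, of x] by linarith
  have int_I: "integrable lborel (\<lambda>x. \<bar>w (real (Suc k) / B)\<bar> * indicator (?I k) x)" for k
    using B by (intro integrable_mult_right integrable_real_indicator)
      (auto simp: emeasure_lborel_Ioc divide_right_mono)
  have "(\<Sum>k<m. \<bar>w (real (Suc k) / B)\<bar>) / B = (\<Sum>k<m. \<bar>w (real (Suc k) / B)\<bar> * (\<integral>x. indicator (?I k) x \<partial>lborel))"
    using B by (simp add: sum_divide_distrib divide_right_mono field_simps)
  also have "\<dots> = (\<integral>x. (\<Sum>k<m. \<bar>w (real (Suc k) / B)\<bar> * indicator (?I k) x) \<partial>lborel)"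
    using int_I by (subst Bochner_Integration.integral_sum) auto
  also have "\<dots> \<le> (\<integral>x. indicator {0..} x * wbar w x \<partial>lborel)"
  proof (rule integral_mono)
    fix x :: real
    show "(\<Sum>k<m. \<bar>w (real (Suc k) / B)\<bar> * indicator (?I k) x) \<le> indicator {0..} x * wbar w x"
    proof (cases "\<exists>k<m. x \<in> ?I k")
      case True
      then obtain k where k: "k < m" "x \<in> ?I k" by auto
      have "x \<notin> ?I l" if "l \<noteq> k" for l
      proof
        assume "x \<in> ?I l"
        with k(2) B have "real k < real (Suc l)" "real l < real (Suc k)"
          by (auto simp: field_simps)
        with that show False by auto
      qed
      then have "(\<Sum>l<m. \<bar>w (real (Suc l) / B)\<bar> * indicator (?I l) x)
          = (\<Sum>l<m. if l = k then \<bar>w (real (Suc k) / B)\<bar> else 0)"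
        using k by (intro sum.cong) (auto simp del: of_nat_Suc)
      also have "\<dots> = \<bar>w (real (Suc k) / B)\<bar>" using k by simp
      also have "\<dots> \<le> wbar w x" using k by (intro wbar_ge[OF w]) auto
      also have "\<dots> = indicator {0..} x * wbar w x"
      proof -
        have "0 \<le> real k / B" using B by simp
        then have "0 \<le> x" using k(2) by auto
        then show ?thesis by simp
      qed
      finally show ?thesis .
    next
      case False
      then have "(\<Sum>l<m. \<bar>w (real (Suc l) / B)\<bar> * indicator (?I l) x) = 0"
        by (intro sum.neutral) (auto simp del: of_nat_Suc)
      then show ?thesis using nn by simp
    qed
  qed (intro Bochner_Integration.integrable_sum int_I int)+
  finally show ?thesis using B
    by (simp add: set_lebesgue_integral_def field_simps)
qed

text \<open>Evenness of \<open>w\<close> folds the two-sided sum onto the nonnegative lags. The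
  constant does not depend on \<open>n\<close>, so the lag window has effective length of order
  \<open>B\<close>.\<close>

lemma kernel_sum_le:
  assumes w: "in_W w"
  obtains C where "\<And>B n. 1 \<le> B \<Longrightarrow> (\<Sum>j\<in>{-(int n)<..<int n}. \<bar>w (real_of_int j / B)\<bar>) \<le> C * B"
proof -
  define I where "I = (\<integral>x\<in>{0..}. wbar w x \<partial>lborel)"
  have nn: "0 \<le> wbar w x" for x
    using wbar_ge[OF w order_refl, of x] by linarith
  have I0: "0 \<le> I" unfolding I_def set_lebesgue_integral_def using nn by simp
  show thesis
  proof (rule that[of "2 * (1 + I)"])
    fix B :: real and n :: nat assume B: "1 \<le> B"
    define c where "c k = (if k < n then \<bar>w (real k / B)\<bar> else 0)" for k :: nat
    have sm: "summable c" by (rule summable_finite[of "{..<n}"]) (auto simp: c_def)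
    have "\<bar>w (real_of_int j / B)\<bar> = c (nat \<bar>j\<bar>)" if "j \<in> {-(int n)<..<int n}" for j
    proof -
      have "w (real_of_int j / B) = w (real (nat \<bar>j\<bar>) / B)"
      proof (cases "j \<ge> 0")
        case False
        have "w (real_of_int j / B) = w (- (real_of_int j / B))"
          using w by (simp add: in_W_def)
        with False show ?thesis by simp
      qed simp
      moreover have "nat \<bar>j\<bar> < n" using that by auto
      ultimately show ?thesis by (simp add: c_def)
    qed
    then have "(\<Sum>j\<in>{-(int n)<..<int n}. \<bar>w (real_of_int j / B)\<bar>) = (\<Sum>j\<in>{-(int n)<..<int n}. c (nat \<bar>j\<bar>))"
      by (intro sum.cong) auto
    also have "\<dots> \<le> 2 * (\<Sum>k. c k)"
      by (rule sum_nat_abs_le[OF sm]) (auto simp: c_def)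
    also have "(\<Sum>k. c k) = (\<Sum>k<n. \<bar>w (real k / B)\<bar>)"
      by (subst suminf_finite[of "{..<n}"]) (auto simp: c_def)
    also have "\<dots> \<le> B * (1 + I)"
    proof (cases n)
      case 0 then show ?thesis using B I0 by simp
    next
      case (Suc m)
      \<comment> \<open>Lag 0 is not a right endpoint; its term is \<open>w 0 = 1\<close>, absorbed
        by \<open>B\<close> since \<open>1 \<le> B\<close>.\<close>
      have "(\<Sum>k<n. \<bar>w (real k / B)\<bar>) = 1 + (\<Sum>k<m. \<bar>w (real (Suc k) / B)\<bar>)"
        using w unfolding Suc sum.lessThan_Suc_shift by (simp add: in_W_def)
      also have "\<dots> \<le> B + B * I"
        using kernel_sum_nat_le[OF w, of B m] B by (simp add: I_def)
      finally show ?thesis by (simp add: algebra_simps)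
    qed
    finally show "(\<Sum>j\<in>{-(int n)<..<int n}. \<bar>w (real_of_int j / B)\<bar>) \<le> 2 * (1 + I) * B"
      by (simp add: algebra_simps)
  qed
qed

text \<open>Bounding the cosine by 1 before letting \<open>n\<close> grow leaves a majorant free of
  \<open>lam\<close>, so the bias vanishes uniformly in the frequency. The factor
  \<open>1 - \<bar>j\<bar> / n\<close> is the share of the \<open>n\<close> time points that have a
  partner at lag \<open>j\<close>.\<close>

lemma kernel_bias_tendsto_0:
  fixes r :: "int \<Rightarrow> real" and B :: "nat \<Rightarrow> real"
  assumes w: "in_W w" and B: "filterlim B at_top sequentially"
    and r: "integrable (count_space UNIV) r"
  obtains b where "b \<longlonglongrightarrow> 0"
    "\<And>n lam. \<bar>(\<Sum>j\<in>{-(int n)<..<int n}. w (real_of_int j / B n) * ((1 - real_of_int \<bar>j\<bar> / real n) * r j)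
        * cos (real_of_int j * lam)) - (\<Sum>\<^sub>\<infinity>j. r j * cos (real_of_int j * lam))\<bar> \<le> b n"
proof -
  obtain K where K: "1 \<le> K" "\<And>x. \<bar>w x\<bar> \<le> K" using in_W_bounded[OF w] by blast
  \<comment> \<open>Extension by zero to all lags: \<open>k n j\<close> tends to 1 for each fixed
    \<open>j\<close> and is bounded by \<open>K\<close>, so \<open>(K + 1) * \<bar>r j\<bar>\<close>
    dominates.\<close>
  define k where "k n j = (if j \<in> {-(int n)<..<int n} then w (real_of_int j / B n) * (1 - real_of_int \<bar>j\<bar> / real n) else 0)"
    for n j
  have k_bnd: "\<bar>k n j\<bar> \<le> K" for n j
  proof (cases "j \<in> {-(int n)<..<int n}")
    case True
    then have "\<bar>1 - real_of_int \<bar>j\<bar> / real n\<bar> \<le> 1"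
      by (auto simp: abs_le_iff field_simps)
    then have "\<bar>w (real_of_int j / B n)\<bar> * \<bar>1 - real_of_int \<bar>j\<bar> / real n\<bar> \<le> K * 1"
      using K by (intro mult_mono) auto
    with True show ?thesis by (simp add: k_def abs_mult)
  qed (use K in \<open>auto simp: k_def\<close>)
  have k_lim: "(\<lambda>n. k n j) \<longlonglongrightarrow> 1" for j
  proof -
    have "(\<lambda>n. real_of_int j / B n) \<longlonglongrightarrow> 0"
      by (rule real_tendsto_divide_at_top[OF tendsto_const B])
    moreover have "isCont w 0"
      using w continuous_on_eq_continuous_at[of UNIV w] by (auto simp: in_W_def)
    ultimately have 1: "(\<lambda>n. w (real_of_int j / B n)) \<longlonglongrightarrow> 1"
      using isCont_tendsto_compose[of 0 w] w by (force simp: in_W_def)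
    have "(\<lambda>n. real_of_int \<bar>j\<bar> / real n) \<longlonglongrightarrow> 0"
      by (rule real_tendsto_divide_at_top[OF tendsto_const filterlim_real_sequentially])
    from tendsto_mult[OF 1 tendsto_diff[OF tendsto_const this, of 1]]
    have lim: "(\<lambda>n. w (real_of_int j / B n) * (1 - real_of_int \<bar>j\<bar> / real n)) \<longlonglongrightarrow> 1" by simp
    have "eventually (\<lambda>n. w (real_of_int j / B n) * (1 - real_of_int \<bar>j\<bar> / real n) = k n j) sequentially"
      using eventually_gt_at_top[of "nat \<bar>j\<bar>"] by eventually_elim (auto simp: k_def)
    with lim show ?thesis by (rule Lim_transform_eventually)
  qed
  define b where "b n = (\<integral>j. \<bar>(k n j - 1) * r j\<bar> \<partial>count_space UNIV)" for n
  have kr_bnd: "\<bar>(k n j - 1) * r j\<bar> \<le> (K + 1) * \<bar>r j\<bar>" for n j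
    unfolding abs_mult using k_bnd[of n j] by (intro mult_right_mono) linarith+
  have int_b: "integrable (count_space UNIV) (\<lambda>j. (k n j - 1) * r j)" for n
    by (rule Bochner_Integration.integrable_bound[of _ "\<lambda>j. (K + 1) * \<bar>r j\<bar>"])
      (use r kr_bnd K in \<open>auto intro: order_trans abs_ge_self\<close>)
  have "b \<longlonglongrightarrow> (\<integral>j. 0 \<partial>count_space (UNIV :: int set))"
    unfolding b_def
  proof (rule integral_dominated_convergence[where w="\<lambda>j. (K + 1) * \<bar>r j\<bar>"])
    show "AE j in count_space UNIV. (\<lambda>n. \<bar>(k n j - 1) * r j\<bar>) \<longlonglongrightarrow> 0"
    proof (rule AE_I2)
      fix j
      from tendsto_rabs[OF tendsto_mult_right[OF tendsto_diff[OF k_lim[of j] tendsto_const], of 1 "r j"]]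
      show "(\<lambda>n. \<bar>(k n j - 1) * r j\<bar>) \<longlonglongrightarrow> 0" by simp
    qed
  qed (use r kr_bnd in auto)
  then have "b \<longlonglongrightarrow> 0" by simp
  moreover have "\<bar>(\<Sum>j\<in>{-(int n)<..<int n}. w (real_of_int j / B n) * ((1 - real_of_int \<bar>j\<bar> / real n) * r j)
        * cos (real_of_int j * lam)) - (\<Sum>\<^sub>\<infinity>j. r j * cos (real_of_int j * lam))\<bar> \<le> b n" for n lam
  proof -
    let ?c = "\<lambda>j::int. cos (real_of_int j * lam)"
    have int_c: "integrable (count_space UNIV) (\<lambda>j. f j * ?c j)"
      if "integrable (count_space UNIV) f" for f :: "int \<Rightarrow> real"
      by (rule Bochner_Integration.integrable_bound[OF that]) (auto simp: abs_mult intro!: mult_left_le)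
    have int_k: "integrable (count_space UNIV) (\<lambda>j. k n j * r j)"
      using Bochner_Integration.integrable_add[OF int_b[of n] r] by (simp add: algebra_simps)
    have "(\<Sum>j\<in>{-(int n)<..<int n}. w (real_of_int j / B n) * ((1 - real_of_int \<bar>j\<bar> / real n) * r j) * ?c j)
        = (\<Sum>j\<in>{-(int n)<..<int n}. k n j * r j * ?c j)"
      by (intro sum.cong) (auto simp: k_def)
    also have "\<dots> = (\<Sum>j | j \<in> UNIV \<and> k n j * r j * ?c j \<noteq> 0. k n j * r j * ?c j)"
      by (intro sum.mono_neutral_right) (auto simp: k_def split: if_splits)
    also have "\<dots> = (\<integral>j. k n j * r j * ?c j \<partial>count_space UNIV)"
      by (rule lebesgue_integral_count_space_finite_support[symmetric], rule finite_subset[of _ "{-(int n)<..<int n}"])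
        (auto simp: k_def split: if_splits)
    finally have "(\<Sum>j\<in>{-(int n)<..<int n}. w (real_of_int j / B n) * ((1 - real_of_int \<bar>j\<bar> / real n) * r j) * ?c j)
        - (\<Sum>\<^sub>\<infinity>j. r j * ?c j) = (\<integral>j. k n j * r j * ?c j - r j * ?c j \<partial>count_space UNIV)"
      using infsum_eq_integral_count_space[OF int_c[OF r]] int_c[OF r] int_c[OF int_k] by simp
    also have "\<bar>\<dots>\<bar> \<le> (\<integral>j. \<bar>k n j * r j * ?c j - r j * ?c j\<bar> \<partial>count_space UNIV)"
      by (rule integral_abs_bound)
    also have "\<dots> \<le> b n"
      unfolding b_def
    proof (rule integral_mono)
      fix j
      have "\<bar>k n j * r j * ?c j - r j * ?c j\<bar> = \<bar>(k n j - 1) * r j\<bar> * \<bar>?c j\<bar>"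
        by (simp add: abs_mult[symmetric] algebra_simps)
      also have "\<dots> \<le> \<bar>(k n j - 1) * r j\<bar>" by (intro mult_left_le) auto
      finally show "\<bar>k n j * r j * ?c j - r j * ?c j\<bar> \<le> \<bar>(k n j - 1) * r j\<bar>" .
    qed (use int_b int_c[OF r] int_c[OF int_k] in auto)
    finally show ?thesis .
  qed
  ultimately show thesis by (rule that)
qed

text \<open>\<open>ind_lt x u - \<tau>\<close> is a subgradient at \<open>u\<close> of the convex
  function that maps \<xi> to \<open>rho \<tau> (x - \<xi>)\<close>.\<close>

lemma rho_subgradient: "rho \<tau> (x - u) - rho \<tau> (x - q) \<le> (u - q) * (ind_lt x u - \<tau>)"
  by (auto simp: rho_def ind_lt_def algebra_simps)

text \<open>By convexity, a strict sign of the score sum at a test level \<open>u\<close> tells on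
  which side of \<open>u\<close> every minimizer lies. The level \<open>u\<close> can be
  deterministic, so moment bounds apply there.\<close>

lemma quantile_min_subgradient:
  assumes "is_quantile_min Y eps \<tau> n \<omega> q"
  shows "0 \<le> (u - q) * (\<Sum>t\<in>{1..int n}. ind_lt (Xs Y eps t \<omega>) u - \<tau>)"
proof -
  have "0 \<le> (\<Sum>t\<in>{1..int n}. rho \<tau> (Xs Y eps t \<omega> - u) - rho \<tau> (Xs Y eps t \<omega> - q))"
    using assms by (simp add: is_quantile_min_def sum_subtractf)
  also have "\<dots> \<le> (\<Sum>t\<in>{1..int n}. (u - q) * (ind_lt (Xs Y eps t \<omega>) u - \<tau>))"
    by (intro sum_mono rho_subgradient)
  finally show ?thesis by (simp add: sum_distrib_left)
qed

lemma ind_lt_mono: "u \<le> v \<Longrightarrow> ind_lt x u \<le> ind_lt x v"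
  by (auto simp: ind_lt_def)

text \<open>Both quantiles lie in \<open>[u, v]\<close>, so by monotonicity in the level the total change of the
  indicators is at most the number of observations in \<open>[u, v)\<close>, uniformly in the lag \<open>j\<close>.\<close>
lemma r_hat_diff_le:
  assumes "u \<le> p" "p \<le> v" "u \<le> q" "q \<le> v" "0 < \<tau>" "\<tau> < 1"
  shows "\<bar>r_hat Y eps \<tau> n p j \<omega> - r_hat Y eps \<tau> n q j \<omega>\<bar>
    \<le> 2 / real n * (\<Sum>t\<in>{1..int n}. ind_lt (Xs Y eps t \<omega>) v - ind_lt (Xs Y eps t \<omega>) u)"
proof -
  define D where "D t = ind_lt (Xs Y eps t \<omega>) v - ind_lt (Xs Y eps t \<omega>) u" for t
  have D0: "0 \<le> D t" for t unfolding D_def using ind_lt_mono[of u v] assms by simp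
  have Vd: "\<bar>Vt Y eps \<tau> p t \<omega> - Vt Y eps \<tau> q t \<omega>\<bar> \<le> D t" for t
    using assms by (auto simp: Vt_def D_def ind_lt_def)
  have V1: "\<bar>Vt Y eps \<tau> x t \<omega>\<bar> \<le> 1" for x t
    using assms by (auto simp: Vt_def ind_lt_def)
  have "(\<Sum>t\<in>{\<bar>j\<bar>+1..int n}. D t + D (t - \<bar>j\<bar>))
      = sum D {\<bar>j\<bar>+1..int n} + sum D ((\<lambda>t. t - \<bar>j\<bar>) ` {\<bar>j\<bar>+1..int n})"
    by (subst sum.reindex) (auto simp: inj_on_def sum.distrib)
  also have "\<dots> \<le> sum D {1..int n} + sum D {1..int n}"
    using D0 by (intro add_mono sum_mono2) auto
  finally have le: "(\<Sum>t\<in>{\<bar>j\<bar>+1..int n}. D t + D (t - \<bar>j\<bar>)) \<le> 2 * sum D {1..int n}" by simp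
  have "\<bar>r_hat Y eps \<tau> n p j \<omega> - r_hat Y eps \<tau> n q j \<omega>\<bar>
      = 1 / real n * \<bar>\<Sum>t\<in>{\<bar>j\<bar>+1..int n}. Vt Y eps \<tau> p t \<omega> * Vt Y eps \<tau> p (t - \<bar>j\<bar>) \<omega>
          - Vt Y eps \<tau> q t \<omega> * Vt Y eps \<tau> q (t - \<bar>j\<bar>) \<omega>\<bar>"
    by (simp add: r_hat_def sum_subtractf diff_divide_distrib[symmetric] abs_divide)
  also have "\<dots> \<le> 1 / real n * (\<Sum>t\<in>{\<bar>j\<bar>+1..int n}. D t + D (t - \<bar>j\<bar>))"
    by (intro mult_left_mono order_trans[OF sum_abs] sum_mono order_trans[OF abs_mult_diff_le] add_mono Vd V1) auto
  also have "\<dots> \<le> 1 / real n * (2 * sum D {1..int n})"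
    by (intro mult_left_mono le) auto
  finally show ?thesis by (simp add: D_def)
qed

subsection \<open>Causal processes\<close>

text \<open>The option index puts the noise and the copy \<open>e0s\<close> into one independent
  family, with \<open>None\<close> in the same role as in \<open>influence\<close>.\<close>

locale causal_process = prob_space M for M :: "'w measure" +
  fixes N :: "'e measure" and eps :: "int \<Rightarrow> 'w \<Rightarrow> 'e" and e0s :: "'w \<Rightarrow> 'e"
    and Y :: "(nat \<Rightarrow> 'e) \<Rightarrow> real"
  assumes indep: "indep_vars (\<lambda>_. N) (\<lambda>i. case i of None \<Rightarrow> e0s | Some t \<Rightarrow> eps t) UNIV"
    and ident: "\<And>t. distr M N (eps t) = distr M N (eps 0)"
    and ident_star: "distr M N e0s = distr M N (eps 0)"
    and Y_meas: "Y \<in> borel_measurable (Pi\<^sub>M UNIV (\<lambda>_. N))"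
begin

abbreviation law :: "'e measure" where
  "law \<equiv> distr M N (eps 0)"

abbreviation X :: "int \<Rightarrow> 'w \<Rightarrow> real" where
  "X \<equiv> Xs Y eps"

definition score :: "real \<Rightarrow> real \<Rightarrow> (nat \<Rightarrow> 'e) \<Rightarrow> real" where
  "score \<tau> \<xi> x = \<tau> - ind_lt (Y x) \<xi>"

lemma noise_coord_measurable: "(case i of None \<Rightarrow> e0s | Some t \<Rightarrow> eps t) \<in> M \<rightarrow>\<^sub>M N"
  using indep by (simp add: indep_vars_def2)

lemma eps_measurable: "eps t \<in> M \<rightarrow>\<^sub>M N"
  using noise_coord_measurable[of "Some t"] by simp

lemma prob_space_law: "prob_space law"
  by (rule prob_space_distr[OF eps_measurable])

sublocale law: prob_space law
  by (rule prob_space_law)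

lemma sets_iid_law: "sets (iid_PiM law :: ('i \<Rightarrow> 'e) measure) = sets (iid_PiM N)"
  by (intro sets_PiM_cong) auto

lemma Y_measurable: "Y \<in> borel_measurable (iid_PiM law)"
  using Y_meas measurable_cong_sets[OF sets_iid_law refl] by blast

lemma noise_measurable:
  "(\<lambda>\<omega> i. (case i of None \<Rightarrow> e0s | Some t \<Rightarrow> eps t) \<omega>) \<in> M \<rightarrow>\<^sub>M iid_PiM law"
  "(\<lambda>\<omega> t. eps t \<omega>) \<in> M \<rightarrow>\<^sub>M iid_PiM law"
  using noise_coord_measurable eps_measurable
    measurable_space[OF noise_coord_measurable] measurable_space[OF eps_measurable]
  by (auto intro!: measurable_PiM_single' simp: space_PiM)

text \<open>Independence makes the joint law a product, and identical laws make all factors equal.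
  Expectations over the noise thus become integrals over a space whose coordinates may be
  permuted.\<close>

lemma distr_noise:
  "distr M (iid_PiM law) (\<lambda>\<omega> i. (case i of None \<Rightarrow> e0s | Some t \<Rightarrow> eps t) \<omega>) = iid_PiM law"
proof -
  let ?e = "\<lambda>i. case i of None \<Rightarrow> e0s | Some t \<Rightarrow> eps t"
  have "distr M (iid_PiM N) (\<lambda>\<omega>. \<lambda>i\<in>UNIV. ?e i \<omega>) = PiM UNIV (\<lambda>i. distr M N (?e i))"
    using indep noise_coord_measurable by (subst (asm) indep_vars_iff_distr_eq_PiM') auto
  moreover have "distr M N (?e i) = law" for i
    using ident ident_star by (cases i) auto
  ultimately have "distr M (iid_PiM N) (\<lambda>\<omega> i. ?e i \<omega>) = iid_PiM law"
    by (simp add: restrict_def)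
  moreover have "distr M (iid_PiM N) (\<lambda>\<omega> i. ?e i \<omega>) = distr M (iid_PiM law) (\<lambda>\<omega> i. ?e i \<omega>)"
    by (intro distr_cong sets_iid_law[symmetric] refl)
  ultimately show ?thesis by simp
qed

lemma expectation_noise_option:
  fixes f :: "(int option \<Rightarrow> 'e) \<Rightarrow> real"
  assumes "f \<in> borel_measurable (iid_PiM law)"
  shows "expectation (\<lambda>\<omega>. f (\<lambda>i. (case i of None \<Rightarrow> e0s | Some t \<Rightarrow> eps t) \<omega>)) = (\<integral>x. f x \<partial>iid_PiM law)"
  using integral_distr[OF noise_measurable(1) assms] by (simp add: distr_noise)

lemma expectation_noise:
  fixes f :: "(int \<Rightarrow> 'e) \<Rightarrow> real"
  assumes f: "f \<in> borel_measurable (iid_PiM law)"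
  shows "expectation (\<lambda>\<omega>. f (\<lambda>t. eps t \<omega>)) = (\<integral>x. f x \<partial>iid_PiM law)"
proof -
  have "expectation (\<lambda>\<omega>. f (\<lambda>t. eps t \<omega>)) = (\<integral>x. f (\<lambda>t. x (Some t)) \<partial>iid_PiM law)"
    using expectation_noise_option[OF measurable_compose_reindex[OF f, of Some]] by simp
  also have "\<dots> = (\<integral>x. f x \<partial>iid_PiM law)"
    by (rule law.integral_reindex[OF _ f]) simp
  finally show ?thesis .
qed

lemma past_measurable:
  assumes "z \<in> borel_measurable (iid_PiM law)"
  shows "(\<lambda>\<omega>. z (\<lambda>k. eps (t - int k) \<omega>)) \<in> borel_measurable M"
  by (rule measurable_compose[OF noise_measurable(2) measurable_compose_reindex[OF assms]])

lemma expectation_past: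
  fixes z :: "(nat \<Rightarrow> 'e) \<Rightarrow> real"
  assumes z: "z \<in> borel_measurable (iid_PiM law)"
  shows "expectation (\<lambda>\<omega>. z (\<lambda>k. eps (t - int k) \<omega>)) = (\<integral>x. z x \<partial>iid_PiM law)"
  using expectation_noise[OF measurable_compose_reindex[OF z]] law.integral_stationary[OF z] by simp

text \<open>Stated with a majorant \<theta> instead of the influences themselves, so that one
  constant serves a whole range of levels.\<close>

lemma second_moment_sum_le:
  fixes z :: "(nat \<Rightarrow> 'e) \<Rightarrow> real"
  assumes z: "z \<in> borel_measurable (iid_PiM law)" "\<And>x. \<bar>z x\<bar> \<le> C"
    and S: "summable \<theta>" "\<And>i. influence law z i \<le> \<theta> i" and T: "finite T"
  shows "expectation (\<lambda>\<omega>. (\<Sum>t\<in>T. z (\<lambda>k. eps (t - int k) \<omega>) - (\<integral>x. z x \<partial>iid_PiM law))\<^sup>2)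
    \<le> real (card T) * (\<Sum>i. \<theta> i)\<^sup>2"
proof -
  have sm: "summable (influence law z)"
    by (rule summable_comparison_test'[OF S(1), of 0]) (use S(2) in auto)
  have "(\<lambda>x. (\<Sum>t\<in>T. z (\<lambda>k. x (t - int k)) - (\<integral>x. z x \<partial>iid_PiM law))\<^sup>2) \<in> borel_measurable (iid_PiM law)"
    by (intro borel_measurable_power borel_measurable_sum borel_measurable_diff borel_measurable_const
        measurable_compose_reindex[OF z(1)])
  from expectation_noise[OF this]
  have "expectation (\<lambda>\<omega>. (\<Sum>t\<in>T. z (\<lambda>k. eps (t - int k) \<omega>) - (\<integral>x. z x \<partial>iid_PiM law))\<^sup>2)
      \<le> real (card T) * (\<Sum>i. influence law z i)\<^sup>2"
    using law.variance_sum_le[OF z sm T] by simp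
  also have "\<dots> \<le> real (card T) * (\<Sum>i. \<theta> i)\<^sup>2"
    by (intro mult_left_mono power_mono suminf_le S sm suminf_nonneg) auto
  finally show ?thesis .
qed

lemma X_measurable: "X t \<in> borel_measurable M"
  unfolding Xs_def using past_measurable[OF Y_measurable] by simp

lemma score_measurable: "score \<tau> \<xi> \<in> borel_measurable (iid_PiM law)"
  using Y_measurable unfolding score_def ind_lt_def by measurable

lemma score_bound: "0 < \<tau> \<Longrightarrow> \<tau> < 1 \<Longrightarrow> \<bar>score \<tau> \<xi> x\<bar> \<le> 1"
  by (auto simp: score_def ind_lt_def)

lemma Vt_eq_score: "Vt Y eps \<tau> \<xi> t \<omega> = score \<tau> \<xi> (\<lambda>k. eps (t - int k) \<omega>)"
  by (simp add: Vt_def score_def Xs_def)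

text \<open>\<open>ind_lt\<close> produces the strict event, while \<open>FX\<close> is defined with
  \<le>; near the quantile the two agree because the Lipschitz condition excludes atoms.\<close>

lemma integral_score:
  "(\<integral>x. score \<tau> \<xi> x \<partial>iid_PiM law) = \<tau> - prob {\<omega> \<in> space M. X 0 \<omega> < \<xi>}"
proof -
  have A: "{\<omega> \<in> space M. X 0 \<omega> < \<xi>} \<in> events" using X_measurable by measurable
  have "(\<integral>x. score \<tau> \<xi> x \<partial>iid_PiM law) = expectation (\<lambda>\<omega>. score \<tau> \<xi> (\<lambda>k. eps (0 - int k) \<omega>))"
    by (rule expectation_past[OF score_measurable, symmetric])
  also have "\<dots> = expectation (\<lambda>\<omega>. \<tau> - indicator {\<omega> \<in> space M. X 0 \<omega> < \<xi>} \<omega>)"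
    by (intro Bochner_Integration.integral_cong) (auto simp: score_def ind_lt_def Xs_def)
  also have "\<dots> = \<tau> - prob {\<omega> \<in> space M. X 0 \<omega> < \<xi>}"
    using A by (subst Bochner_Integration.integral_diff) (auto simp: prob_space emeasure_eq_measure)
  finally show ?thesis .
qed

text \<open>In the past of time \<open>i\<close>, coordinate \<open>i\<close> is
  \<open>eps 0\<close>; replacing it by \<open>e0s\<close> turns \<open>X\<close> into
  \<open>Xstar\<close>. The series in (C) is thereby a series of suprema of influences.\<close>

lemma influence_score:
  "influence law (score \<tau> \<xi>) i
    = L2norm M (\<lambda>\<omega>. ind_lt (X (int i) \<omega>) \<xi> - ind_lt (Xstar Y eps e0s (int i) \<omega>) \<xi>)"
proof -
  define \<psi> where "\<psi> = map_option (\<lambda>k. int i - int k)"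
  have "inj \<psi>" unfolding \<psi>_def by (rule option.inj_map) (simp add: inj_def)
  let ?e = "\<lambda>\<omega> i. (case i of None \<Rightarrow> e0s | Some t \<Rightarrow> eps t) \<omega>"
  let ?f = "\<lambda>x :: int option \<Rightarrow> 'e. score \<tau> \<xi> (\<lambda>k. x (\<psi> (Some k)))
      - score \<tau> \<xi> (\<lambda>k. x (\<psi> (if k = i then None else Some k)))"
  have "(\<lambda>x. (?f x)\<^sup>2) \<in> borel_measurable (iid_PiM law)"
    by (intro borel_measurable_power borel_measurable_diff measurable_compose_reindex[OF score_measurable])
  from expectation_noise_option[OF this]
  have "L2norm M (\<lambda>\<omega>. ?f (?e \<omega>)) = L2norm (iid_PiM law) ?f"
    unfolding L2norm_def by (rule arg_cong)
  moreover have "(?f (?e \<omega>))\<^sup>2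
      = (ind_lt (X (int i) \<omega>) \<xi> - ind_lt (Xstar Y eps e0s (int i) \<omega>) \<xi>)\<^sup>2" for \<omega>
  proof -
    have "(\<lambda>k. ?e \<omega> (\<psi> (Some k))) = (\<lambda>k. eps (int i - int k) \<omega>)"
      by (simp add: \<psi>_def)
    moreover have "(\<lambda>k. ?e \<omega> (\<psi> (if k = i then None else Some k)))
        = (\<lambda>k. if int i - int k = 0 then e0s \<omega> else eps (int i - int k) \<omega>)"
      by (auto simp: \<psi>_def fun_eq_iff)
    ultimately show ?thesis
      by (simp only: score_def Xs_def Xstar_def) (simp add: power2_commute)
  qed
  ultimately show ?thesis
    using law.influence_reindex[OF \<open>inj \<psi>\<close> score_measurable, of \<tau> \<xi> i] by (simp add: L2norm_def)
qed

text \<open>Supplies the boundedness under which the supremum over levels in (C) dominates each of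
  its members.\<close>

lemma influence_score_le:
  assumes "0 < \<tau>" "\<tau> < 1"
  shows "influence law (score \<tau> \<xi>) i \<le> 1"
proof -
  interpret P: prob_space "iid_PiM law :: (nat option \<Rightarrow> 'e) measure" by (rule law.prob_space_iid)
  have "influence law (score \<tau> \<xi>) i \<le> L2norm (iid_PiM law :: (nat option \<Rightarrow> 'e) measure) (\<lambda>_. 1)"
    unfolding influence_def
    by (intro L2norm_mono borel_measurable_diff measurable_compose_reindex[OF score_measurable])
      (auto simp: score_def ind_lt_def)
  then show ?thesis by (simp add: L2norm_def P.prob_space)
qed

text \<open>For small positive \<open>h\<close>, the Lipschitz bound gives
  \<open>FX \<xi> - L * h \<le> FX (\<xi> - h)\<close>, and the right side is at most the
  probability of \<open>X 0 < \<xi>\<close>. Let \<open>h\<close> tend to 0.\<close>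

lemma prob_less_eq_FX:
  assumes lip: "\<And>x y. \<bar>x - c\<bar> \<le> \<eta> \<Longrightarrow> \<bar>y - c\<bar> \<le> \<eta> \<Longrightarrow> \<bar>FX M Y eps x - FX M Y eps y\<bar> \<le> L * \<bar>x - y\<bar>"
    and \<xi>: "\<bar>\<xi> - c\<bar> < \<eta>"
  shows "prob {\<omega> \<in> space M. X 0 \<omega> < \<xi>} = FX M Y eps \<xi>"
proof (rule antisym)
  have [measurable]: "X 0 \<in> borel_measurable M" by (rule X_measurable)
  show "prob {\<omega> \<in> space M. X 0 \<omega> < \<xi>} \<le> FX M Y eps \<xi>"
    unfolding FX_def by (rule finite_measure_mono) auto
  have "((\<lambda>h. FX M Y eps \<xi> - L * h) \<longlongrightarrow> FX M Y eps \<xi> - L * 0) (at_right 0)"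
    by (intro tendsto_intros)
  moreover have "eventually (\<lambda>h. FX M Y eps \<xi> - L * h \<le> prob {\<omega> \<in> space M. X 0 \<omega> < \<xi>}) (at_right 0)"
  proof -
    have "eventually (\<lambda>h. h \<in> {0<..<\<eta> - \<bar>\<xi> - c\<bar>}) (at_right 0)"
      using \<xi> by (intro eventually_at_right_real) auto
    then show ?thesis
    proof eventually_elim
      case (elim h)
      have "\<bar>FX M Y eps \<xi> - FX M Y eps (\<xi> - h)\<bar> \<le> L * \<bar>\<xi> - (\<xi> - h)\<bar>"
        using elim \<xi> by (intro lip) auto
      moreover have "FX M Y eps (\<xi> - h) \<le> prob {\<omega> \<in> space M. X 0 \<omega> < \<xi>}"
        unfolding FX_def using elim by (intro finite_measure_mono) auto
      ultimately show ?case using elim by simp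
    qed
  qed
  ultimately have "FX M Y eps \<xi> - L * 0 \<le> prob {\<omega> \<in> space M. X 0 \<omega> < \<xi>}"
    by (intro tendsto_upperbound) auto
  then show "FX M Y eps \<xi> \<le> prob {\<omega> \<in> space M. X 0 \<omega> < \<xi>}" by simp
qed

lemma FX_mono: "x \<le> y \<Longrightarrow> FX M Y eps x \<le> FX M Y eps y"
  unfolding FX_def using X_measurable by (intro finite_measure_mono) auto

text \<open>A gap between \<open>FX\<close> and \<tau> at the quantile would persist nearby by
  continuity: a value too small there pushes the infimum to the right, a value too large admits a
  smaller member of the set.\<close>

lemma FX_xi0:
  assumes \<tau>: "0 < \<tau>" "\<tau> < 1" and \<eta>: "0 < \<eta>"
    and lip: "\<And>x y. \<bar>x - xi0 M Y eps \<tau>\<bar> \<le> \<eta> \<Longrightarrow> \<bar>y - xi0 M Y eps \<tau>\<bar> \<le> \<eta>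
      \<Longrightarrow> \<bar>FX M Y eps x - FX M Y eps y\<bar> \<le> L * \<bar>x - y\<bar>"
  shows "FX M Y eps (xi0 M Y eps \<tau>) = \<tau>"
proof -
  let ?F = "FX M Y eps" and ?q = "xi0 M Y eps \<tau>"
  let ?A = "{x. \<tau> \<le> ?F x}"
  interpret R: real_distribution "distr M borel (X 0)"
    by (rule real_distribution_distr[OF X_measurable])
  have F: "?F = cdf (distr M borel (X 0))"
    using X_measurable by (auto simp: fun_eq_iff FX_def cdf_def measure_distr vimage_def Int_def conj_commute)
  have ne: "?A \<noteq> {}"
  proof -
    have "eventually (\<lambda>x. \<tau> < ?F x) at_top"
      using R.cdf_lim_at_top_prob \<tau> unfolding F by (intro order_tendstoD) auto
    then show ?thesis by (auto simp: eventually_at_top_linorder intro: less_imp_le)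
  qed
  have bdd: "bdd_below ?A"
  proof -
    have "eventually (\<lambda>x. ?F x < \<tau>) at_bot"
      using R.cdf_lim_at_bot \<tau> unfolding F by (intro order_tendstoD) auto
    then obtain x where x: "\<And>y. y \<le> x \<Longrightarrow> ?F y < \<tau>" by (auto simp: eventually_at_bot_linorder)
    then show ?thesis by (intro bdd_belowI[of _ x]) (meson linorder_not_le mem_Collect_eq nle_le)
  qed
  have q: "?q = Inf ?A" by (simp add: xi0_def)
  \<comment> \<open>\<open>L\<close> comes without a sign, and division by the constant
    follows.\<close>
  define L' where "L' = max 1 L"
  have lip': "\<bar>?F (?q + h) - ?F ?q\<bar> \<le> L' * \<bar>h\<bar>" if "\<bar>h\<bar> \<le> \<eta>" for h
  proof -
    have "\<bar>?F (?q + h) - ?F ?q\<bar> \<le> L * \<bar>(?q + h) - ?q\<bar>"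
      using that \<eta> by (intro lip) auto
    also have "\<dots> \<le> L' * \<bar>h\<bar>" unfolding L'_def by (auto intro!: mult_right_mono)
    finally show ?thesis .
  qed
  have L': "L' > 0" by (simp add: L'_def)
  define \<Delta> where "\<Delta> = \<bar>?F ?q - \<tau>\<bar>"
  \<comment> \<open>Over a distance \<open>h\<close> the distribution function moves by at most half
    of the gap \<Delta>.\<close>
  define h where "h = min \<eta> (\<Delta> / (2 * L'))"
  show ?thesis
  proof (rule ccontr)
    assume neq: "?F ?q \<noteq> \<tau>"
    then have "\<Delta> > 0" by (simp add: \<Delta>_def)
    then have h: "h > 0" "h \<le> \<eta>" using \<eta> L' by (auto simp: h_def)
    have "L' * h \<le> L' * (\<Delta> / (2 * L'))" using L' by (intro mult_left_mono) (auto simp: h_def)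
    also have "\<dots> = \<Delta> / 2" using L' by simp
    finally have Lh: "L' * h \<le> \<Delta> / 2" .
    show False
    proof (cases "?F ?q < \<tau>")
      case True
      have "?F (?q + h) < \<tau>"
        using lip'[of h] h Lh True \<open>\<Delta> > 0\<close> unfolding \<Delta>_def by auto
      then have "?q + h \<le> x" if "x \<in> ?A" for x
        using that FX_mono[of x "?q + h"] by (cases "x \<le> ?q + h") auto
      then have "?q + h \<le> Inf ?A" using ne by (intro cInf_greatest) auto
      with q h show False by simp
    next
      case False
      with neq have "?F (?q + (-h)) \<ge> \<tau>"
        using lip'[of "-h"] h Lh \<open>\<Delta> > 0\<close> unfolding \<Delta>_def by auto
      then have "Inf ?A \<le> ?q - h" using bdd by (intro cInf_lower) auto
      with q h show False by simp
    qed
  qed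
qed

text \<open>Translates (B) into facts on the mean score near the quantile: a zero at the quantile, a
  drift of slope at least \<open>c\<close> from the positive density, and at most
  \<open>L * d\<close> mass in the window from the Lipschitz bound.\<close>

lemma quantile_local:
  assumes \<tau>: "0 < \<tau>" "\<tau> < 1"
    and B_lip: "\<exists>\<eta>>0. \<exists>L. \<forall>x y. \<bar>x - xi0 M Y eps \<tau>\<bar> \<le> \<eta> \<longrightarrow> \<bar>y - xi0 M Y eps \<tau>\<bar> \<le> \<eta> \<longrightarrow>
                  \<bar>FX M Y eps x - FX M Y eps y\<bar> \<le> L * \<bar>x - y\<bar>"
    and B_dens: "\<exists>\<eta>>0. \<exists>f. isCont f (xi0 M Y eps \<tau>) \<and> f (xi0 M Y eps \<tau>) > 0 \<and>
                  (\<forall>a b. xi0 M Y eps \<tau> - \<eta> \<le> a \<longrightarrow> a \<le> b \<longrightarrow> b \<le> xi0 M Y eps \<tau> + \<eta> \<longrightarrow>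
                     (f has_integral (FX M Y eps b - FX M Y eps a)) {a..b})"
  obtains \<eta> L c where "0 < \<eta>" "0 < L" "0 < c"
    "(\<integral>x. score \<tau> (xi0 M Y eps \<tau>) x \<partial>iid_PiM law) = 0"
    "\<And>d. 0 \<le> d \<Longrightarrow> d \<le> \<eta> \<Longrightarrow> (\<integral>x. score \<tau> (xi0 M Y eps \<tau> + d) x \<partial>iid_PiM law) \<le> - c * d"
    "\<And>d. 0 \<le> d \<Longrightarrow> d \<le> \<eta> \<Longrightarrow> (\<integral>x. score \<tau> (xi0 M Y eps \<tau> - d) x \<partial>iid_PiM law) \<ge> c * d"
    "\<And>d. 0 \<le> d \<Longrightarrow> d \<le> \<eta> \<Longrightarrow> (\<integral>x. score \<tau> (xi0 M Y eps \<tau> - d) x \<partial>iid_PiM law)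
        - (\<integral>x. score \<tau> (xi0 M Y eps \<tau> + d) x \<partial>iid_PiM law) \<le> L * d"
proof -
  let ?F = "FX M Y eps" and ?q = "xi0 M Y eps \<tau>"
  from B_lip obtain \<eta>1 L where \<eta>1: "\<eta>1 > 0" and lip: "\<And>x y. \<bar>x - ?q\<bar> \<le> \<eta>1 \<Longrightarrow> \<bar>y - ?q\<bar> \<le> \<eta>1
      \<Longrightarrow> \<bar>?F x - ?F y\<bar> \<le> L * \<bar>x - y\<bar>" by metis
  from B_dens obtain \<eta>2 f where \<eta>2: "\<eta>2 > 0" and f: "isCont f ?q" "f ?q > 0"
    and hi: "\<And>a b. ?q - \<eta>2 \<le> a \<Longrightarrow> a \<le> b \<Longrightarrow> b \<le> ?q + \<eta>2 \<Longrightarrow> (f has_integral (?F b - ?F a)) {a..b}"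
    by metis
  \<comment> \<open>Half of the density at the quantile; by continuity the density exceeds it
    nearby.\<close>
  define c where "c = f ?q / 2"
  have c: "c > 0" using f by (simp add: c_def)
  obtain \<eta>3 where \<eta>3: "\<eta>3 > 0" "\<And>x. \<bar>x - ?q\<bar> < \<eta>3 \<Longrightarrow> c < f x"
  proof -
    have "eventually (\<lambda>x. c < f x) (nhds ?q)"
      using f by (intro order_tendstoD[of _ "f ?q"]) (auto simp: c_def isCont_def tendsto_at_iff_tendsto_nhds)
    then show thesis using that by (auto simp: eventually_nhds_metric dist_real_def)
  qed
  \<comment> \<open>Halving keeps the closed window strictly inside the regions of radius \<eta>1
    and \<eta>3, where the comparison with \<open>FX\<close> and the density bound require strict
    inequalities.\<close>
  define \<eta> where "\<eta> = min (\<eta>1 / 2) (min \<eta>2 (\<eta>3 / 2))"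
  have \<eta>: "\<eta> > 0" "\<eta> < \<eta>1" "\<eta> \<le> \<eta>2" "\<eta> < \<eta>3" using \<eta>1 \<eta>2 \<eta>3 by (auto simp: \<eta>_def)
  \<comment> \<open>The factor 2 is for the width \<open>2 * d\<close> of the window.\<close>
  define L' where "L' = 2 * max 1 L"
  have G: "(\<integral>x. score \<tau> \<xi> x \<partial>iid_PiM law) = \<tau> - ?F \<xi>" if "\<bar>\<xi> - ?q\<bar> \<le> \<eta>" for \<xi>
    unfolding integral_score using prob_less_eq_FX[of ?q \<eta>1 L \<xi>, OF lip] that \<eta> by simp
  have Fq: "?F ?q = \<tau>" by (rule FX_xi0[OF \<tau> \<eta>1 lip])
  have inc: "c * (b - a) \<le> ?F b - ?F a" if "?q - \<eta> \<le> a" "a \<le> b" "b \<le> ?q + \<eta>" for a b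
  proof (rule has_integral_le)
    show "((\<lambda>_. c) has_integral c * (b - a)) {a..b}"
      using has_integral_const_real[of c a b] that by (simp add: mult.commute)
    show "(f has_integral (?F b - ?F a)) {a..b}" using that \<eta> by (intro hi) auto
    show "c \<le> f x" if "x \<in> {a..b}" for x
      using \<eta>3(2)[of x] that \<open>?q - \<eta> \<le> a\<close> \<open>b \<le> ?q + \<eta>\<close> \<eta> by (auto simp: abs_le_iff abs_less_iff)
  qed
  show thesis
  proof (rule that[of \<eta> L' c])
    show "(\<integral>x. score \<tau> ?q x \<partial>iid_PiM law) = 0" using G[of ?q] \<eta> Fq by simp
    fix d :: real assume d: "0 \<le> d" "d \<le> \<eta>"
    show "(\<integral>x. score \<tau> (?q + d) x \<partial>iid_PiM law) \<le> - c * d"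
      using G[of "?q + d"] inc[of ?q "?q + d"] d \<eta> Fq by simp
    show "(\<integral>x. score \<tau> (?q - d) x \<partial>iid_PiM law) \<ge> c * d"
      using G[of "?q - d"] inc[of "?q - d" ?q] d \<eta> Fq by simp
    have "\<bar>?F (?q + d) - ?F (?q - d)\<bar> \<le> L * \<bar>(?q + d) - (?q - d)\<bar>"
      using d \<eta> by (intro lip) auto
    also have "\<dots> \<le> L' * d"
      using d mult_right_mono[of L "max 1 L" d] by (simp add: L'_def)
    finally show "(\<integral>x. score \<tau> (?q - d) x \<partial>iid_PiM law)
        - (\<integral>x. score \<tau> (?q + d) x \<partial>iid_PiM law) \<le> L' * d"
      using G[of "?q + d"] G[of "?q - d"] d by simp
  qed (use \<eta> c in \<open>auto simp: L'_def\<close>)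
qed

end

section \<open>Deviation of score sums and mean error of sample autocovariances\<close>

lemma (in prob_space) expectation_abs_le_L2norm:
  assumes f: "f \<in> borel_measurable M" "\<And>x. \<bar>f x\<bar> \<le> C"
  shows "expectation (\<lambda>x. \<bar>f x\<bar>) \<le> L2norm M f"
proof -
  have "\<bar>expectation (\<lambda>x. \<bar>f x\<bar> * 1)\<bar> \<le> L2norm M (\<lambda>x. \<bar>f x\<bar>) * L2norm M (\<lambda>_. 1)"
  proof (rule Cauchy_Schwarz_integral)
    have "(f x)\<^sup>2 \<le> C\<^sup>2" for x using f(2)[of x] by (metis abs_ge_zero power2_abs power_mono)
    then show "integrable M (\<lambda>x. \<bar>f x\<bar>\<^sup>2)"
      using f(1) by (intro integrable_bounded[of _ "C\<^sup>2"]) auto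
    show "integrable M (\<lambda>x. \<bar>f x\<bar> * 1)" using f by (intro integrable_bounded[of _ C]) auto
  qed auto
  then show ?thesis by (simp add: L2norm_def prob_space)
qed

context causal_process
begin

lemma Vt_measurable: "Vt Y eps \<tau> \<xi> t \<in> borel_measurable M"
  using past_measurable[OF score_measurable[of \<tau> \<xi>], of t] by (simp add: Vt_eq_score[abs_def])

lemma r_hat_measurable: "r_hat Y eps \<tau> n \<xi> j \<in> borel_measurable M"
  unfolding r_hat_def[abs_def] using Vt_measurable by measurable

lemma Vt_bound: "0 < \<tau> \<Longrightarrow> \<tau> < 1 \<Longrightarrow> \<bar>Vt Y eps \<tau> \<xi> t \<omega>\<bar> \<le> 1"
  by (auto simp: Vt_def ind_lt_def)

lemma r_hat_bound:
  assumes "0 < \<tau>" "\<tau> < 1"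
  shows "\<bar>r_hat Y eps \<tau> n \<xi> j \<omega>\<bar> \<le> 1"
proof -
  have "\<bar>\<Sum>t\<in>{\<bar>j\<bar>+1..int n}. Vt Y eps \<tau> \<xi> t \<omega> * Vt Y eps \<tau> \<xi> (t - \<bar>j\<bar>) \<omega>\<bar>
      \<le> (\<Sum>t\<in>{\<bar>j\<bar>+1..int n}. 1)"
    using Vt_bound[OF assms, of \<xi>]
    by (intro order_trans[OF sum_abs] sum_mono) (auto simp: abs_mult intro!: mult_le_one)
  also have "\<dots> \<le> real n" by simp
  finally show ?thesis by (cases "n = 0") (auto simp: r_hat_def abs_divide)
qed

lemma r_tau_eq_autocov:
  assumes "(\<integral>x. score \<tau> (xi0 M Y eps \<tau>) x \<partial>iid_PiM law) = 0"
  shows "r_tau M Y eps \<tau> j = law.autocov (score \<tau> (xi0 M Y eps \<tau>)) (nat \<bar>j\<bar>)"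
proof -
  let ?z = "score \<tau> (xi0 M Y eps \<tau>)"
  have "r_tau M Y eps \<tau> j = expectation (\<lambda>\<omega>. ?z (\<lambda>k. eps (0 - int k) \<omega>) * ?z (\<lambda>k. eps (j - int k) \<omega>))"
    by (simp add: r_tau_def Vt_eq_score)
  also have "\<dots> = (\<integral>x. ?z (\<lambda>k. x (0 - int k)) * ?z (\<lambda>k. x (j - int k)) \<partial>iid_PiM law)"
    by (rule expectation_noise)
      (intro borel_measurable_times measurable_compose_reindex[OF score_measurable])
  also have "\<dots> = law.autocov ?z (nat \<bar>j\<bar>)"
    unfolding law.integral_stationary_mult[OF score_measurable] assms by simp
  finally show ?thesis .
qed

lemma score_deviation:
  assumes \<tau>: "0 < \<tau>" "\<tau> < 1" and S: "summable \<theta>" "\<And>i. influence law (score \<tau> \<xi>) i \<le> \<theta> i" and a: "0 < a"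
  shows "prob {\<omega> \<in> space M. \<bar>\<Sum>t\<in>{1..int n}. Vt Y eps \<tau> \<xi> t \<omega> - (\<integral>x. score \<tau> \<xi> x \<partial>iid_PiM law)\<bar> \<ge> a}
    \<le> real n * (\<Sum>i. \<theta> i)\<^sup>2 / a\<^sup>2"
proof -
  let ?\<mu> = "\<integral>x. score \<tau> \<xi> x \<partial>iid_PiM law"
  let ?S = "\<lambda>\<omega>. \<Sum>t\<in>{1..int n}. Vt Y eps \<tau> \<xi> t \<omega> - ?\<mu>"
  have [measurable]: "?S \<in> borel_measurable M" using Vt_measurable by measurable
  have "\<bar>?S \<omega>\<bar> \<le> real n * (1 + \<bar>?\<mu>\<bar>)" for \<omega>
  proof -
    have "\<bar>?S \<omega>\<bar> \<le> (\<Sum>t\<in>{1..int n}. 1 + \<bar>?\<mu>\<bar>)"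
      by (intro order_trans[OF sum_abs] sum_mono order_trans[OF abs_triangle_ineq4] add_mono Vt_bound \<tau>) auto
    then show ?thesis by simp
  qed
  then have "(?S \<omega>)\<^sup>2 \<le> (real n * (1 + \<bar>?\<mu>\<bar>))\<^sup>2" for \<omega>
    by (metis abs_ge_zero power2_abs power_mono)
  then have int: "integrable M (\<lambda>\<omega>. (?S \<omega>)\<^sup>2)"
    by (intro integrable_bounded[of _ "(real n * (1 + \<bar>?\<mu>\<bar>))\<^sup>2"]) auto
  have "prob {\<omega> \<in> space M. \<bar>?S \<omega>\<bar> \<ge> a} \<le> expectation (\<lambda>\<omega>. (?S \<omega>)\<^sup>2) / a\<^sup>2"
    using int a by (intro second_moment_method) auto
  also have "expectation (\<lambda>\<omega>. (?S \<omega>)\<^sup>2) \<le> real (card {1..int n}) * (\<Sum>i. \<theta> i)\<^sup>2"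
    unfolding Vt_eq_score
    by (rule second_moment_sum_le[OF score_measurable score_bound[OF \<tau>] S]) simp
  finally show ?thesis by (simp add: divide_right_mono)
qed

text \<open>At a level of mean score zero, \<open>r_hat\<close> is a sum of stationary products
  divided by \<open>n\<close>, and its mean is the subtracted term. The variance bound for sums
  gives the rate, with a constant that does not involve the lag.\<close>

lemma expectation_r_hat_error:
  assumes \<tau>: "0 < \<tau>" "\<tau> < 1" and S: "summable \<theta>" "\<And>i. influence law (score \<tau> \<xi>) i \<le> \<theta> i"
    and mean: "(\<integral>x. score \<tau> \<xi> x \<partial>iid_PiM law) = 0" and j: "\<bar>j\<bar> < int n"
  shows "expectation (\<lambda>\<omega>. \<bar>r_hat Y eps \<tau> n \<xi> j \<omega>
      - (1 - real_of_int \<bar>j\<bar> / real n) * law.autocov (score \<tau> \<xi>) (nat \<bar>j\<bar>)\<bar>)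
    \<le> 2 * (\<Sum>i. \<theta> i) / sqrt (real n)"
proof -
  let ?v = "score \<tau> \<xi>"
  define h where "h = nat \<bar>j\<bar>"
  define z where "z = (\<lambda>x. ?v x * ?v (\<lambda>k. x (k + h)))"
  define \<mu> where "\<mu> = law.autocov ?v h"
  define R where "R = (\<lambda>\<omega>. r_hat Y eps \<tau> n \<xi> j \<omega> - (1 - real_of_int \<bar>j\<bar> / real n) * \<mu>)"
  \<comment> \<open>One summand per factor of the product; both series have the same sum, so the
    total is twice that of \<theta> for every \<open>h\<close>.\<close>
  define \<theta>' where "\<theta>' i = \<theta> i + (if h \<le> i then \<theta> (i - h) else 0)" for i
  let ?T = "{\<bar>j\<bar>+1..int n}"
  have n: "n > 0" using j by auto
  have \<theta>0: "0 \<le> \<theta> i" for i using S(2)[of i] influence_nonneg order_trans by blast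
  have shift: "(\<lambda>x. ?v (\<lambda>k. x (k + h))) \<in> borel_measurable (iid_PiM law)"
    by (rule measurable_compose_reindex[OF score_measurable])
  have z: "z \<in> borel_measurable (iid_PiM law)"
    unfolding z_def using score_measurable shift by measurable
  have zb: "\<bar>z x\<bar> \<le> 1" for x
    unfolding z_def abs_mult using score_bound[OF \<tau>] by (intro mult_le_one) auto
  have zm: "(\<integral>x. z x \<partial>iid_PiM law) = \<mu>"
    using mean by (simp add: z_def \<mu>_def law.autocov_def)
  have infl: "influence law z i \<le> \<theta>' i" for i
  proof -
    have "influence law z i \<le> influence law ?v i + influence law (\<lambda>x. ?v (\<lambda>k. x (k + h))) i"
      unfolding z_def by (rule law.influence_mult_le[OF score_measurable score_bound[OF \<tau>] shift score_bound[OF \<tau>]])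
    also have "\<dots> \<le> \<theta>' i"
      unfolding law.influence_shift[OF score_measurable] \<theta>'_def using S(2) by (intro add_mono) auto
    finally show ?thesis .
  qed
  have sm_shift: "summable (\<lambda>i. if h \<le> i then \<theta> (i - h) else 0)"
    by (subst summable_iff_shift[symmetric, of _ h]) (use S in simp)
  have sm: "summable \<theta>'" unfolding \<theta>'_def by (intro summable_add S sm_shift)
  have sum: "(\<Sum>i. \<theta>' i) = 2 * (\<Sum>i. \<theta> i)"
    using suminf_split_initial_segment[OF sm_shift, of h] suminf_add[OF S(1) sm_shift]
    by (simp add: \<theta>'_def)
  have card: "real (card ?T) = real n - real_of_int \<bar>j\<bar>" using j by auto
  have R_eq: "R \<omega> = (\<Sum>t\<in>?T. z (\<lambda>k. eps (t - int k) \<omega>) - \<mu>) / real n" for \<omega>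
  proof -
    have "Vt Y eps \<tau> \<xi> t \<omega> * Vt Y eps \<tau> \<xi> (t - \<bar>j\<bar>) \<omega> = z (\<lambda>k. eps (t - int k) \<omega>)" for t
    proof -
      \<comment> \<open>The lagged factor is the earlier one, so it reads the past of time
        \<open>t\<close> shifted by \<open>h\<close>.\<close>
      have "t - \<bar>j\<bar> - int k = t - int (k + h)" for k by (simp add: h_def)
      then show ?thesis by (simp only: Vt_eq_score z_def)
    qed
    then have "r_hat Y eps \<tau> n \<xi> j \<omega> = (\<Sum>t\<in>?T. z (\<lambda>k. eps (t - int k) \<omega>)) / real n"
      by (simp add: r_hat_def)
    moreover have "(1 - real_of_int \<bar>j\<bar> / real n) * \<mu> = real (card ?T) * \<mu> / real n"
      unfolding card using n by (simp add: field_simps)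
    ultimately show ?thesis by (simp add: R_def sum_subtractf diff_divide_distrib)
  qed
  have "expectation (\<lambda>\<omega>. (R \<omega>)\<^sup>2)
      = expectation (\<lambda>\<omega>. (\<Sum>t\<in>?T. z (\<lambda>k. eps (t - int k) \<omega>) - \<mu>)\<^sup>2) / (real n)\<^sup>2"
    by (simp add: R_eq power_divide)
  also have "\<dots> \<le> (real (card ?T) * (\<Sum>i. \<theta>' i)\<^sup>2) / (real n)\<^sup>2"
    using second_moment_sum_le[OF z zb sm infl, of ?T] by (simp only: zm finite_atLeastAtMost_int divide_right_mono zero_le_power2)
  also have "\<dots> \<le> (real n * (\<Sum>i. \<theta>' i)\<^sup>2) / (real n)\<^sup>2"
    by (intro divide_right_mono mult_right_mono) auto
  also have "\<dots> = (2 * (\<Sum>i. \<theta> i) / sqrt (real n))\<^sup>2"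
    using n by (simp add: sum power_divide power2_eq_square)
  finally have "L2norm M R \<le> sqrt ((2 * (\<Sum>i. \<theta> i) / sqrt (real n))\<^sup>2)"
    unfolding L2norm_def by (rule real_sqrt_le_mono)
  also have "\<dots> = 2 * (\<Sum>i. \<theta> i) / sqrt (real n)"
    using suminf_nonneg[OF S(1) \<theta>0] by simp
  finally have L2: "L2norm M R \<le> 2 * (\<Sum>i. \<theta> i) / sqrt (real n)" .
  have "expectation (\<lambda>\<omega>. \<bar>R \<omega>\<bar>) \<le> L2norm M R"
  proof (rule expectation_abs_le_L2norm)
    show "R \<in> borel_measurable M" unfolding R_def using r_hat_measurable by measurable
    show "\<bar>R \<omega>\<bar> \<le> 1 + \<bar>(1 - real_of_int \<bar>j\<bar> / real n) * \<mu>\<bar>" for \<omega>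
      unfolding R_def by (rule order_trans[OF abs_triangle_ineq4]) (intro add_mono r_hat_bound \<tau>, simp)
  qed
  with L2 show ?thesis by (simp add: R_def \<mu>_def h_def)
qed

end

text \<open>The bandwidth condition leaves room for a radius that dominates \<open>1 / sqrt n\<close> and is
  dominated by \<open>1 / B n\<close>.\<close>
lemma localization_radius:
  fixes B d :: "nat \<Rightarrow> real"
  assumes B: "filterlim B at_top sequentially" "(\<lambda>n. B n / sqrt (real n)) \<longlonglongrightarrow> 0"
    and d_def: "\<And>n. d n = 1 / sqrt (B n * sqrt (real n))"
  shows "(\<lambda>n. B n * d n) \<longlonglongrightarrow> 0" "d \<longlonglongrightarrow> 0"
    "(\<lambda>n. 1 / (real n * (d n)\<^sup>2)) \<longlonglongrightarrow> 0"
    "eventually (\<lambda>n. 0 < d n) sequentially"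
proof -
  have ev: "eventually (\<lambda>n. 1 \<le> B n \<and> 0 < n) sequentially"
    using B(1) eventually_gt_at_top[of 0] by (intro eventually_conj) (auto simp: filterlim_at_top)
  show pos: "eventually (\<lambda>n. 0 < d n) sequentially"
    using ev by eventually_elim (auto simp: d_def)
  \<comment> \<open>Both rates come from the ratio \<open>B n / sqrt n\<close>: its square root is
    \<open>B n * d n\<close>, and the ratio itself is
    \<open>1 / (n * (d n)\<^sup>2)\<close>.\<close>
  have "(\<lambda>n. sqrt (B n / sqrt (real n))) \<longlonglongrightarrow> sqrt 0"
    by (intro tendsto_real_sqrt B)
  moreover have "eventually (\<lambda>n. sqrt (B n / sqrt (real n)) = B n * d n) sequentially"
    using ev
  proof eventually_elim
    case (elim n)
    have "B n * d n = B n / sqrt (B n) / sqrt (sqrt (real n))"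
      by (simp add: d_def real_sqrt_mult)
    then show ?case
      using elim by (simp add: real_div_sqrt real_sqrt_divide)
  qed
  ultimately show Bd: "(\<lambda>n. B n * d n) \<longlonglongrightarrow> 0"
    by (auto intro: Lim_transform_eventually)
  show "d \<longlonglongrightarrow> 0"
  proof (rule tendsto_sandwich[OF _ _ tendsto_const Bd])
    show "eventually (\<lambda>n. 0 \<le> d n) sequentially" using pos by eventually_elim simp
    show "eventually (\<lambda>n. d n \<le> B n * d n) sequentially"
      using pos ev by eventually_elim simp
  qed
  have "eventually (\<lambda>n. B n / sqrt (real n) = 1 / (real n * (d n)\<^sup>2)) sequentially"
    using ev
  proof eventually_elim
    case (elim n)
    have "real n * (d n)\<^sup>2 = real n / sqrt (real n) / B n"
      using elim by (simp add: d_def power_divide)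
    also have "\<dots> = sqrt (real n) / B n" using elim by (simp add: real_div_sqrt)
    finally show ?case by simp
  qed
  with B(2) show "(\<lambda>n. 1 / (real n * (d n)\<^sup>2)) \<longlonglongrightarrow> 0"
    by (rule Lim_transform_eventually)
qed

subsection \<open>Consistency\<close>

text \<open>A pathwise splitting into replacement of the quantile, centred fluctuation at the
  deterministic level, and bias. The bound contains no \<open>lam\<close>, so it carries over to the
  supremum over frequencies.\<close>

lemma g_hat_error_le:
  fixes r :: "int \<Rightarrow> real"
  assumes D: "\<And>j. \<bar>r_hat Y eps \<tau> n p j \<omega> - r_hat Y eps \<tau> n q j \<omega>\<bar> \<le> D"
    and K: "(\<Sum>j\<in>{-(int n)<..<int n}. \<bar>w (real_of_int j / b)\<bar>) \<le> K"
    and bias: "\<bar>(\<Sum>j\<in>{-(int n)<..<int n}. w (real_of_int j / b) * ((1 - real_of_int \<bar>j\<bar> / real n) * r j)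
        * cos (real_of_int j * lam)) - G\<bar> \<le> \<beta>"
  shows "\<bar>g_hat Y eps \<tau> w b n p \<omega> lam - 1 / (2 * pi) * G\<bar>
    \<le> K * D + (\<Sum>j\<in>{-(int n)<..<int n}. \<bar>w (real_of_int j / b)\<bar> *
        \<bar>r_hat Y eps \<tau> n q j \<omega> - (1 - real_of_int \<bar>j\<bar> / real n) * r j\<bar>) + \<beta>"
proof -
  let ?J = "{-(int n)<..<int n}" and ?w = "\<lambda>j. w (real_of_int j / b)"
    and ?c = "\<lambda>j. cos (real_of_int j * lam)"
    and ?p = "\<lambda>j. r_hat Y eps \<tau> n p j \<omega>" and ?q = "\<lambda>j. r_hat Y eps \<tau> n q j \<omega>"
    and ?m = "\<lambda>j. (1 - real_of_int \<bar>j\<bar> / real n) * r j"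
  have D0: "0 \<le> D" using D[of 0] by linarith
  have split: "(\<Sum>j\<in>?J. ?w j * ?p j * ?c j) - G
      = (\<Sum>j\<in>?J. ?w j * (?p j - ?q j) * ?c j) + (\<Sum>j\<in>?J. ?w j * (?q j - ?m j) * ?c j)
        + ((\<Sum>j\<in>?J. ?w j * ?m j * ?c j) - G)"
    by (simp add: left_diff_distrib right_diff_distrib sum_subtractf)
  have cos_le: "\<bar>?w j * x * ?c j\<bar> \<le> \<bar>?w j\<bar> * \<bar>x\<bar>" for j x
    unfolding abs_mult by (intro mult_left_le) auto
  have 1: "\<bar>\<Sum>j\<in>?J. ?w j * (?p j - ?q j) * ?c j\<bar> \<le> K * D"
  proof -
    have "\<bar>\<Sum>j\<in>?J. ?w j * (?p j - ?q j) * ?c j\<bar> \<le> (\<Sum>j\<in>?J. \<bar>?w j\<bar> * D)"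
      by (intro order_trans[OF sum_abs] sum_mono order_trans[OF cos_le] mult_left_mono D) auto
    also have "\<dots> \<le> K * D"
      unfolding sum_distrib_right[symmetric] by (intro mult_right_mono K D0)
    finally show ?thesis .
  qed
  have 2: "\<bar>\<Sum>j\<in>?J. ?w j * (?q j - ?m j) * ?c j\<bar> \<le> (\<Sum>j\<in>?J. \<bar>?w j\<bar> * \<bar>?q j - ?m j\<bar>)"
    by (intro order_trans[OF sum_abs] sum_mono cos_le)
  have "g_hat Y eps \<tau> w b n p \<omega> lam - 1 / (2 * pi) * G
      = 1 / (2 * pi) * ((\<Sum>j\<in>?J. ?w j * ?p j * ?c j) - G)"
    by (simp add: g_hat_def right_diff_distrib)
  also have "\<bar>\<dots>\<bar> \<le> 1 * \<bar>(\<Sum>j\<in>?J. ?w j * ?p j * ?c j) - G\<bar>"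
    unfolding abs_mult using pi_ge_two by (intro mult_right_mono) auto
  also have "\<dots> \<le> K * D + (\<Sum>j\<in>?J. \<bar>?w j\<bar> * \<bar>?q j - ?m j\<bar>) + \<beta>"
    unfolding split mult_1 by (intro order_trans[OF abs_triangle_ineq] add_mono 1 2 bias)
  finally show ?thesis .
qed

theorem theorem3p6:
  fixes M :: "'w measure" and N :: "'e measure"
    and eps :: "int \<Rightarrow> 'w \<Rightarrow> 'e" and e0s :: "'w \<Rightarrow> 'e"
    and Y :: "(nat \<Rightarrow> 'e) \<Rightarrow> real" and \<tau> :: real
    and w :: "real \<Rightarrow> real" and B :: "nat \<Rightarrow> real"
    and xihat :: "nat \<Rightarrow> 'w \<Rightarrow> real"
  assumes prob: "prob_space M"
    and indep: "prob_space.indep_vars M (\<lambda>_. N)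
                  (\<lambda>i. case i of None \<Rightarrow> e0s | Some t \<Rightarrow> eps t) UNIV"
    and ident: "\<And>t. distr M N (eps t) = distr M N (eps 0)"
    and ident_star: "distr M N e0s = distr M N (eps 0)"
    and Y_meas: "Y \<in> borel_measurable (Pi\<^sub>M UNIV (\<lambda>_. N))"
    and tau: "0 < \<tau>" "\<tau> < 1"
    \<comment> \<open>(B)\<close>
    and B_lip: "\<exists>\<eta>>0. \<exists>L. \<forall>x y. \<bar>x - xi0 M Y eps \<tau>\<bar> \<le> \<eta> \<longrightarrow> \<bar>y - xi0 M Y eps \<tau>\<bar> \<le> \<eta> \<longrightarrow>
                  \<bar>FX M Y eps x - FX M Y eps y\<bar> \<le> L * \<bar>x - y\<bar>"
    and B_dens: "\<exists>\<eta>>0. \<exists>f. isCont f (xi0 M Y eps \<tau>) \<and> f (xi0 M Y eps \<tau>) > 0 \<and>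
                  (\<forall>a b. xi0 M Y eps \<tau> - \<eta> \<le> a \<longrightarrow> a \<le> b \<longrightarrow> b \<le> xi0 M Y eps \<tau> + \<eta> \<longrightarrow>
                     (f has_integral (FX M Y eps b - FX M Y eps a)) {a..b})"
    \<comment> \<open>(C)\<close>
    and C: "\<exists>\<delta>>0. summable (\<lambda>t::nat.
               SUP \<xi>\<in>{\<xi>. \<bar>xi0 M Y eps \<tau> - \<xi>\<bar> \<le> \<delta>}.
                 L2norm M (\<lambda>\<omega>. ind_lt (Xs Y eps (int t) \<omega>) \<xi> - ind_lt (Xstar Y eps e0s (int t) \<omega>) \<xi>))"
    and w: "in_W w"
    and B_inf: "filterlim B at_top sequentially"
    and B_o: "(\<lambda>n. B n / sqrt (real n)) \<longlonglongrightarrow> 0"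
    and xihat_meas: "\<And>n. xihat n \<in> borel_measurable M"
    and xihat_min: "\<And>n \<omega>. \<omega> \<in> space M \<Longrightarrow> is_quantile_min Y eps \<tau> n \<omega> (xihat n \<omega>)"
  shows "\<forall>e>0. (\<lambda>n. measure M {\<omega> \<in> space M.
            (SUP lam\<in>{-pi<..pi}. \<bar>g_hat Y eps \<tau> w (B n) n (xihat n \<omega>) \<omega> lam - g_tau M Y eps \<tau> lam\<bar>) > e})
          \<longlonglongrightarrow> 0"
proof (intro allI impI)
  fix e :: real assume e: "e > 0"
  interpret causal_process M N eps e0s Y
    using prob indep ident ident_star Y_meas
    by (intro causal_process.intro causal_process_axioms.intro)
  let ?q = "xi0 M Y eps \<tau>"
  let ?\<mu> = "\<lambda>\<xi>. \<integral>x. score \<tau> \<xi> x \<partial>iid_PiM law"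
  let ?J = "\<lambda>n::nat. {-(int n)<..<int n}"
  obtain \<eta> L c where pos: "0 < \<eta>" "0 < L" "0 < c" and mean0: "?\<mu> ?q = 0"
    and up: "\<And>d. 0 \<le> d \<Longrightarrow> d \<le> \<eta> \<Longrightarrow> ?\<mu> (?q + d) \<le> - c * d"
    and lo: "\<And>d. 0 \<le> d \<Longrightarrow> d \<le> \<eta> \<Longrightarrow> ?\<mu> (?q - d) \<ge> c * d"
    and width: "\<And>d. 0 \<le> d \<Longrightarrow> d \<le> \<eta> \<Longrightarrow> ?\<mu> (?q - d) - ?\<mu> (?q + d) \<le> L * d"
    using quantile_local[OF tau B_lip B_dens] by blast
  from C obtain \<delta> where \<delta>: "\<delta> > 0" and C': "summable (\<lambda>t::nat. SUP \<xi>\<in>{\<xi>. \<bar>?q - \<xi>\<bar> \<le> \<delta>}.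
      L2norm M (\<lambda>\<omega>. ind_lt (X (int t) \<omega>) \<xi> - ind_lt (Xstar Y eps e0s (int t) \<omega>) \<xi>))" by auto
  \<comment> \<open>One majorant for the level \<open>?q\<close> and for the moving levels
    \<open>?q \<plusminus> d n\<close>, as soon as \<open>d n \<le> \<delta>\<close>.\<close>
  define \<theta> where "\<theta> = (\<lambda>t. SUP \<xi>\<in>{\<xi>. \<bar>?q - \<xi>\<bar> \<le> \<delta>}. influence law (score \<tau> \<xi>) t)"
  have sm: "summable \<theta>" using C' by (simp add: \<theta>_def influence_score)
  have infl: "influence law (score \<tau> \<xi>) i \<le> \<theta> i" if "\<bar>?q - \<xi>\<bar> \<le> \<delta>" for \<xi> i
    unfolding \<theta>_def using that influence_score_le[OF tau] by (intro cSUP_upper bdd_aboveI2) auto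
  define \<Theta> where "\<Theta> = (\<Sum>i. \<theta> i)"
  have infl_q: "influence law (score \<tau> ?q) i \<le> \<theta> i" for i using \<delta> by (intro infl) auto
  have sm_q: "summable (influence law (score \<tau> ?q))"
    by (rule summable_comparison_test'[OF sm, of 0]) (use infl_q in auto)
  define r where "r j = law.autocov (score \<tau> ?q) (nat \<bar>j\<bar>)" for j :: int
  have r_tau: "r_tau M Y eps \<tau> = r"
    using r_tau_eq_autocov[OF mean0] by (simp add: fun_eq_iff r_def)
  have "integrable (count_space UNIV) (\<lambda>j::int. \<bar>law.autocov (score \<tau> ?q) (nat \<bar>j\<bar>)\<bar>)"
    by (rule integrable_count_space_nat_abs
        [OF law.autocov_summable(1)[OF score_measurable score_bound[OF tau] sm_q]]) simp
  then have r_int: "integrable (count_space UNIV) r"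
    by (simp add: r_def[abs_def] integrable_abs_iff)
  obtain b where b: "b \<longlonglongrightarrow> 0" and bias: "\<And>n lam. \<bar>(\<Sum>j\<in>?J n. w (real_of_int j / B n)
      * ((1 - real_of_int \<bar>j\<bar> / real n) * r j) * cos (real_of_int j * lam))
      - (\<Sum>\<^sub>\<infinity>j. r j * cos (real_of_int j * lam))\<bar> \<le> b n"
    using kernel_bias_tendsto_0[OF w B_inf r_int] by blast
  obtain K where K: "\<And>b n. 1 \<le> b \<Longrightarrow> (\<Sum>j\<in>?J n. \<bar>w (real_of_int j / b)\<bar>) \<le> K * b"
    using kernel_sum_le[OF w] by blast
  define d where "d n = 1 / sqrt (B n * sqrt (real n))" for n
  note radius = localization_radius[OF B_inf B_o d_def]
  \<comment> \<open>Used with \<open>s = 1\<close> and \<open>s = -1\<close>. The threshold is half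
    of the guaranteed drift \<open>n * c * d n\<close>, so outside these events the score sum keeps
    the sign of its mean.\<close>
  define E where "E s n = {\<omega> \<in> space M. real n * (c / 2 * d n)
      \<le> \<bar>\<Sum>t\<in>{1..int n}. Vt Y eps \<tau> (?q + s * d n) t \<omega> - ?\<mu> (?q + s * d n)\<bar>}" for s n
  define U where "U n \<omega> = (\<Sum>j\<in>?J n. \<bar>w (real_of_int j / B n)\<bar> *
      \<bar>r_hat Y eps \<tau> n ?q j \<omega> - (1 - real_of_int \<bar>j\<bar> / real n) * r j\<bar>)" for n \<omega>
  define EU where "EU n = {\<omega> \<in> space M. e / 3 \<le> U n \<omega>}" for n
  have E_sets: "E s n \<in> events" for s n
    unfolding E_def using Vt_measurable by measurable
  have U_meas: "U n \<in> borel_measurable M" for n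
    unfolding U_def[abs_def] using r_hat_measurable by measurable
  have EU_sets: "EU n \<in> events" for n
    unfolding EU_def using U_meas by measurable
  have U_nonneg: "0 \<le> U n \<omega>" for n \<omega>
    unfolding U_def by (intro sum_nonneg mult_nonneg_nonneg) auto
  let ?bad = "\<lambda>n. {\<omega> \<in> space M. (SUP lam\<in>{-pi<..pi}.
      \<bar>g_hat Y eps \<tau> w (B n) n (xihat n \<omega>) \<omega> lam - g_tau M Y eps \<tau> lam\<bar>) > e}"
  \<comment> \<open>The count in the window is at most \<open>n * ((L + c) * d n)\<close>, and
    passing to \<open>r_hat\<close> multiplies it by \<open>2 / n\<close>.\<close>
  define D where "D n = 2 * (L + c) * d n" for n
  have ev: "eventually (\<lambda>n. 0 < n \<and> 1 \<le> B n \<and> 0 < d n \<and> d n \<le> \<eta> \<and> d n \<le> \<delta>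
      \<and> K * B n * D n \<le> e / 3 \<and> b n \<le> e / 3) sequentially"
  proof -
    have "(\<lambda>n. (K * (2 * (L + c))) * (B n * d n)) \<longlonglongrightarrow> (K * (2 * (L + c))) * 0"
      by (rule tendsto_mult_left[OF radius(1)])
    then have "(\<lambda>n. K * B n * D n) \<longlonglongrightarrow> 0" by (simp add: D_def mult_ac)
    then have "eventually (\<lambda>n. K * B n * D n < e / 3) sequentially"
      using e by (intro order_tendstoD) auto
    moreover have "eventually (\<lambda>n. d n < \<eta>) sequentially" "eventually (\<lambda>n. d n < \<delta>) sequentially"
      "eventually (\<lambda>n. b n < e / 3) sequentially"
      using pos \<delta> e by (auto intro: order_tendstoD(2)[OF radius(2)] order_tendstoD(2)[OF b] simp del: less_divide_eq_numeral1)
    moreover have "eventually (\<lambda>n. 1 \<le> B n) sequentially"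
      using B_inf by (simp add: filterlim_at_top)
    moreover note radius(4) eventually_gt_at_top[of "0::nat"]
    ultimately show ?thesis by eventually_elim auto
  qed
  have bad_sub: "?bad n \<subseteq> E 1 n \<union> E (-1) n \<union> EU n"
    if n: "0 < n" "1 \<le> B n" "0 < d n" "d n \<le> \<eta>" "K * B n * D n \<le> e / 3" "b n \<le> e / 3" for n
  proof (rule ccontr)
    assume "\<not> ?thesis"
    then obtain \<omega> where \<omega>: "\<omega> \<in> space M" "\<omega> \<notin> E 1 n" "\<omega> \<notin> E (-1) n" "\<omega> \<notin> EU n"
      and large: "(SUP lam\<in>{-pi<..pi}.
        \<bar>g_hat Y eps \<tau> w (B n) n (xihat n \<omega>) \<omega> lam - g_tau M Y eps \<tau> lam\<bar>) > e" by auto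
    let ?S = "\<lambda>\<xi>. \<Sum>t\<in>{1..int n}. Vt Y eps \<tau> \<xi> t \<omega>"
    let ?u = "?q - d n" and ?v = "?q + d n" and ?p = "xihat n \<omega>"
    have dev: "\<bar>?S ?v - real n * ?\<mu> ?v\<bar> < real n * (c * d n) / 2"
      "\<bar>?S ?u - real n * ?\<mu> ?u\<bar> < real n * (c * d n) / 2"
      using \<omega> by (auto simp: E_def sum_subtractf)
    have grad: "0 \<le> (\<xi> - ?p) * (- ?S \<xi>)" for \<xi>
      using quantile_min_subgradient[OF xihat_min[OF \<omega>(1), of n], of \<xi>]
      by (simp add: Vt_def sum_subtractf)
    have "real n * ?\<mu> ?v \<le> - (real n * (c * d n))" "real n * (c * d n) \<le> real n * ?\<mu> ?u"
      using mult_left_mono[OF up[of "d n"], of "real n"] mult_left_mono[OF lo[of "d n"], of "real n"] n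
      by simp_all
    moreover have "0 < real n * (c * d n)" using n pos by simp
    \<comment> \<open>A deviation below half of the drift cannot change a sign; by convexity every
      minimizer then lies between \<open>?u\<close> and \<open>?v\<close>.\<close>
    ultimately have "?S ?v < 0" "0 < ?S ?u"
      using dev unfolding abs_less_iff by linarith+
    then have p: "?u \<le> ?p" "?p \<le> ?v"
      using grad[of ?u] grad[of ?v] by (auto simp: mult_le_0_iff)
    have "(\<Sum>t\<in>{1..int n}. ind_lt (X t \<omega>) ?v - ind_lt (X t \<omega>) ?u) = ?S ?u - ?S ?v"
      by (simp add: Vt_def sum_subtractf)
    \<comment> \<open>The two deviations, each below half of \<open>n * c * d n\<close>, add up to
      the last term.\<close>
    also have "\<dots> \<le> real n * (?\<mu> ?u - ?\<mu> ?v) + real n * (c * d n)"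
      using dev unfolding right_diff_distrib abs_less_iff by linarith
    also have "\<dots> \<le> real n * (L * d n) + real n * (c * d n)"
      using width[of "d n"] n by (intro add_right_mono mult_left_mono) auto
    finally have cnt: "(\<Sum>t\<in>{1..int n}. ind_lt (X t \<omega>) ?v - ind_lt (X t \<omega>) ?u)
        \<le> real n * ((L + c) * d n)" by (simp add: algebra_simps)
    have r_diff: "\<bar>r_hat Y eps \<tau> n ?p j \<omega> - r_hat Y eps \<tau> n ?q j \<omega>\<bar> \<le> D n" for j
    proof -
      have "\<bar>r_hat Y eps \<tau> n ?p j \<omega> - r_hat Y eps \<tau> n ?q j \<omega>\<bar>
          \<le> 2 / real n * (\<Sum>t\<in>{1..int n}. ind_lt (X t \<omega>) ?v - ind_lt (X t \<omega>) ?u)"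
        using p n tau by (intro r_hat_diff_le) auto
      also have "\<dots> \<le> 2 / real n * (real n * ((L + c) * d n))"
        by (intro mult_left_mono cnt) auto
      also have "\<dots> = D n" using n by (simp add: D_def)
      finally show ?thesis .
    qed
    have "\<bar>g_hat Y eps \<tau> w (B n) n ?p \<omega> lam - g_tau M Y eps \<tau> lam\<bar> \<le> e" for lam
    proof -
      have "\<bar>g_hat Y eps \<tau> w (B n) n ?p \<omega> lam - g_tau M Y eps \<tau> lam\<bar>
          \<le> K * B n * D n + U n \<omega> + b n"
        unfolding g_tau_def r_tau U_def by (rule g_hat_error_le[OF r_diff K[OF n(2)] bias])
      moreover have "U n \<omega> < e / 3" using \<omega> by (auto simp: EU_def)
      ultimately show ?thesis using n by simp
    qed
    then have "(SUP lam\<in>{-pi<..pi}.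
        \<bar>g_hat Y eps \<tau> w (B n) n ?p \<omega> lam - g_tau M Y eps \<tau> lam\<bar>) \<le> e"
      by (intro cSUP_least) auto
    with large show False by simp
  qed
  \<comment> \<open>\<open>P1\<close> is Chebyshev's bound at the threshold of \<open>E\<close>;
    \<open>P2\<close> is Markov's bound at \<open>e / 3\<close>, with mean error
    \<open>2 * \<Theta> / sqrt n\<close> per lag and total weight \<open>K * B n\<close>.\<close>
  define P1 where "P1 n = 4 * \<Theta>\<^sup>2 / c\<^sup>2 * (1 / (real n * (d n)\<^sup>2))" for n
  define P2 where "P2 n = K * (2 * \<Theta>) / (e / 3) * (B n / sqrt (real n))" for n
  have prob_E: "prob (E s n) \<le> P1 n" if n: "0 < n" "0 < d n" "d n \<le> \<delta>" and s: "\<bar>s\<bar> = 1" for s n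
  proof -
    have "prob (E s n) \<le> real n * \<Theta>\<^sup>2 / (real n * (c / 2 * d n))\<^sup>2"
      unfolding E_def \<Theta>_def
      by (rule score_deviation[OF tau sm infl]) (use n s pos in \<open>auto simp: abs_mult\<close>)
    also have "\<dots> = P1 n"
      using n pos by (simp add: P1_def power_mult_distrib power_divide field_simps power2_eq_square)
    finally show ?thesis .
  qed
  have prob_EU: "prob (EU n) \<le> P2 n" if n: "0 < n" "1 \<le> B n" for n
  proof -
    let ?R = "\<lambda>j \<omega>. \<bar>r_hat Y eps \<tau> n ?q j \<omega> - (1 - real_of_int \<bar>j\<bar> / real n) * r j\<bar>"
    have R_int: "integrable M (?R j)" for j
    proof (rule integrable_bounded)
      show "?R j \<in> borel_measurable M" using r_hat_measurable by measurable
      show "\<bar>?R j \<omega>\<bar> \<le> 1 + \<bar>(1 - real_of_int \<bar>j\<bar> / real n) * r j\<bar>" for \<omega>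
        unfolding abs_idempotent
        by (rule order_trans[OF abs_triangle_ineq4]) (intro add_mono r_hat_bound tau, simp)
    qed
    have U_int: "integrable M (U n)"
      unfolding U_def[abs_def] by (intro Bochner_Integration.integrable_sum integrable_mult_right R_int)
    have "expectation (U n) = (\<Sum>j\<in>?J n. \<bar>w (real_of_int j / B n)\<bar> * expectation (?R j))"
      unfolding U_def using R_int by (subst Bochner_Integration.integral_sum) auto
    also have "\<dots> \<le> (\<Sum>j\<in>?J n. \<bar>w (real_of_int j / B n)\<bar> * (2 * \<Theta> / sqrt (real n)))"
      unfolding r_def \<Theta>_def
      by (intro sum_mono mult_left_mono expectation_r_hat_error[OF tau sm infl_q mean0]) auto
    also have "\<dots> \<le> K * B n * (2 * \<Theta> / sqrt (real n))"
    proof -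
      have "0 \<le> \<Theta>" unfolding \<Theta>_def
        using sm order_trans[OF influence_nonneg infl_q] by (intro suminf_nonneg)
      then show ?thesis
        unfolding sum_distrib_right[symmetric] by (intro mult_right_mono K n) auto
    qed
    finally have EU_le: "expectation (U n) \<le> K * B n * (2 * \<Theta> / sqrt (real n))" .
    have "prob (EU n) \<le> expectation (U n) / (e / 3)"
      unfolding EU_def using U_int e
      by (intro integral_Markov_inequality_measure[where A="{}"]) (auto intro: U_nonneg)
    also have "\<dots> \<le> K * B n * (2 * \<Theta> / sqrt (real n)) / (e / 3)"
      using EU_le e by (intro divide_right_mono) auto
    also have "\<dots> = P2 n" by (simp add: P2_def mult_ac)
    finally show ?thesis .
  qed
  have bound: "eventually (\<lambda>n. prob (?bad n) \<le> P1 n + P1 n + P2 n) sequentially"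
    using ev
  proof eventually_elim
    case (elim n)
    have "prob (?bad n) \<le> prob (E 1 n \<union> E (-1) n \<union> EU n)"
      using elim by (intro finite_measure_mono bad_sub sets.Un E_sets EU_sets) auto
    also have "\<dots> \<le> prob (E 1 n) + prob (E (-1) n) + prob (EU n)"
      by (intro order_trans[OF measure_Un_le] add_right_mono measure_Un_le
          sets.Un E_sets EU_sets)
    also have "\<dots> \<le> P1 n + P1 n + P2 n"
      using elim by (intro add_mono prob_E prob_EU) auto
    finally show ?case .
  qed
  have "(\<lambda>n. P1 n + P1 n + P2 n) \<longlonglongrightarrow> 4 * \<Theta>\<^sup>2 / c\<^sup>2 * 0 + 4 * \<Theta>\<^sup>2 / c\<^sup>2 * 0 + K * (2 * \<Theta>) / (e / 3) * 0"
    unfolding P1_def P2_def by (intro tendsto_add tendsto_mult_left radius B_o)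
  then have "(\<lambda>n. P1 n + P1 n + P2 n) \<longlonglongrightarrow> 0" by simp
  then show "(\<lambda>n. prob (?bad n)) \<longlonglongrightarrow> 0"
    using bound by (intro tendsto_sandwich[OF _ bound tendsto_const]) auto
qed

end
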